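(* Suppose that $\Omega$ is a hyperbolic Riemann surface and that $f\colon\Omega\to\mathbb{C}$ is analytic and unbounded. Then either $\eta_\Omega(f)=\infty$ and $f\in\mathcal{B}$, or $\eta_\Omega(f)=0$ and $f\notin\mathcal{B}$.
   Context: Let $f\colon\Omega\to\mathbb{C}$ be analytic. A point $s\in\mathbb{C}$ is a regular value of $f$ if there is an open neighbourhood $U$ of $s$ such that for every connected component $V$ of $f^{-1}(U)$ the map $f\colon V\to U$ is a conformal isomorphism; otherwise $s$ is a singular value. $S(f)\subset\mathbb{C}$ is the set of singular values. One says $f\in\mathcal{B}$ (the Eremenko-Lyubich class on $\Omega$) if $S(f)$ is bounded. Define $$\eta_\Omega(f):=\lim_{R\to\infty}\ \inf_{z\in\Omega\colon |f(z)|>R}\|Df(z)\|,$$ where the norm of the derivative is measured using the hyperbolic metric $\rho_\Omega$ on $\Omega$ and the cylindrical metric $|dw|/|w|$ on the range; that is, in a local coordinate, $\|Df(z)\|=\dfrac{|f'(z)|}{|f(z)|\,\rho_\Omega(z)}$. *)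

theory Defs
  imports "HOL-Complex_Analysis.Complex_Analysis"
begin

section \<open>Riemann surfaces and analytic maps\<close>

text \<open>A chart is a pair of its domain and a coordinate map. The coordinate map is a total
  function of which only the values on the domain matter; its inverse is taken on the domain.\<close>

type_synonym 'a chart = "'a set \<times> ('a \<Rightarrow> complex)"

abbreviation chart_inv :: "'a chart \<Rightarrow> complex \<Rightarrow> 'a" where
  "chart_inv c \<equiv> inv_into (fst c) (snd c)"

definition complex_chart_on :: "'a::t2_space set \<Rightarrow> 'a chart \<Rightarrow> bool" where
  "complex_chart_on X c \<longleftrightarrow>
     openin (top_of_set X) (fst c) \<and> open (snd c ` fst c) \<and>
     homeomorphism (fst c) (snd c ` fst c) (snd c) (chart_inv c)"

text \<open>The surface is a subset \<open>X\<close> of a Hausdorff space with the subspace topology. Second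
  countability is not demanded: it is a consequence (Rado's theorem), and it is immediate for
  the surfaces covered by the disc below.\<close>

definition riemann_surface :: "'a::t2_space set \<Rightarrow> 'a chart set \<Rightarrow> bool" where
  "riemann_surface X A \<longleftrightarrow>
     X \<noteq> {} \<and> connected X \<and>
     (\<forall>c\<in>A. complex_chart_on X c) \<and> (\<Union>c\<in>A. fst c) = X \<and>
     (\<forall>c\<in>A. \<forall>d\<in>A. (snd c \<circ> chart_inv d) holomorphic_on (snd d ` (fst c \<inter> fst d)))"

definition analytic_to_plane ::
    "'a::t2_space chart set \<Rightarrow> ('a \<Rightarrow> complex) \<Rightarrow> 'a set \<Rightarrow> bool" where
  "analytic_to_plane A f V \<longleftrightarrow>
     (\<forall>c\<in>A. (f \<circ> chart_inv c) holomorphic_on (snd c ` (fst c \<inter> V)))"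

definition analytic_from_plane ::
    "'a::t2_space chart set \<Rightarrow> (complex \<Rightarrow> 'a) \<Rightarrow> complex set \<Rightarrow> bool" where
  "analytic_from_plane A g U \<longleftrightarrow>
     continuous_on U g \<and> (\<forall>c\<in>A. (snd c \<circ> g) holomorphic_on {w\<in>U. g w \<in> fst c})"

definition conformal_isomorphism ::
    "'a::t2_space chart set \<Rightarrow> ('a \<Rightarrow> complex) \<Rightarrow> 'a set \<Rightarrow> complex set \<Rightarrow> bool" where
  "conformal_isomorphism A f V U \<longleftrightarrow>
     bij_betw f V U \<and> analytic_to_plane A f V \<and> analytic_from_plane A (inv_into V f) U"


section \<open>The hyperbolic metric\<close>

definition disc_covering ::
    "'a::t2_space set \<Rightarrow> 'a chart set \<Rightarrow> (complex \<Rightarrow> 'a) \<Rightarrow> bool" where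
  "disc_covering X A p \<longleftrightarrow>
     covering_space (ball 0 1) p X \<and> analytic_from_plane A p (ball 0 1)"

text \<open>Hyperbolic means that the universal covering surface is conformally the unit disc.\<close>

definition hyperbolic_surface :: "'a::t2_space set \<Rightarrow> 'a chart set \<Rightarrow> bool" where
  "hyperbolic_surface X A \<longleftrightarrow> riemann_surface X A \<and> (\<exists>p. disc_covering X A p)"

text \<open>The density at \<open>z\<close>, with respect to the coordinate of the chart \<open>c\<close>, of the metric whose
  pull-back under a universal covering is the metric \<open>2 |d\<zeta>| / (1 - |\<zeta>|\<^sup>2)\<close> of the unit disc.
  By invariance of the latter under conformal automorphisms, the number \<open>r\<close> depends neither on
  the covering \<open>p\<close> nor on the point \<open>\<zeta>\<close> over \<open>z\<close>.\<close>

definition hyperbolic_density ::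
    "'a::t2_space set \<Rightarrow> 'a chart set \<Rightarrow> 'a chart \<Rightarrow> 'a \<Rightarrow> real" where
  "hyperbolic_density X A c z =
     (SOME r. \<exists>p \<zeta>. disc_covering X A p \<and> \<zeta> \<in> ball 0 1 \<and> p \<zeta> = z \<and>
                     r * cmod (deriv (snd c \<circ> p) \<zeta>) = 2 / (1 - (cmod \<zeta>)\<^sup>2))"

text \<open>The norm of the derivative from the hyperbolic metric to the cylindrical metric
  \<open>|dw| / |w|\<close>. Changing the chart multiplies numerator and density by the same factor.\<close>

definition chart_at :: "'a chart set \<Rightarrow> 'a \<Rightarrow> 'a chart" where
  "chart_at A z = (SOME c. c \<in> A \<and> z \<in> fst c)"

definition deriv_norm ::
    "'a::t2_space set \<Rightarrow> 'a chart set \<Rightarrow> ('a \<Rightarrow> complex) \<Rightarrow> 'a \<Rightarrow> real" where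
  "deriv_norm X A f z =
     (let c = chart_at A z in
        cmod (deriv (f \<circ> chart_inv c) (snd c z)) / (cmod (f z) * hyperbolic_density X A c z))"

text \<open>The infimum is monotone in \<open>R\<close>, so the limit exists in the extended reals.\<close>

definition eta :: "'a::t2_space set \<Rightarrow> 'a chart set \<Rightarrow> ('a \<Rightarrow> complex) \<Rightarrow> ereal" where
  "eta X A f =
     Lim at_top (\<lambda>R::real. INF z\<in>{z\<in>X. cmod (f z) > R}. ereal (deriv_norm X A f z))"


section \<open>Singular values and the Eremenko--Lyubich class\<close>

definition regular_value ::
    "'a::t2_space set \<Rightarrow> 'a chart set \<Rightarrow> ('a \<Rightarrow> complex) \<Rightarrow> complex \<Rightarrow> bool" where
  "regular_value X A f s \<longleftrightarrow>
     (\<exists>U. open U \<and> s \<in> U \<and>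
          (\<forall>V\<in>components {z\<in>X. f z \<in> U}. conformal_isomorphism A f V U))"

definition singular_values ::
    "'a::t2_space set \<Rightarrow> 'a chart set \<Rightarrow> ('a \<Rightarrow> complex) \<Rightarrow> complex set" where
  "singular_values X A f = {s. \<not> regular_value X A f s}"

definition class_B :: "'a::t2_space set \<Rightarrow> 'a chart set \<Rightarrow> ('a \<Rightarrow> complex) set" where
  "class_B X A = {f. analytic_to_plane A f X \<and> bounded (singular_values X A f)}"

end

theory Submission
  imports Defs
begin

text \<open>
  Let \<open>p\<close> be a covering of \<open>\<Omega>\<close> by the unit disc and \<open>F = f \<circ> p\<close>. The norm of \<open>Df\<close> at \<open>p \<zeta>\<close> is
  \<open>|F' \<zeta>| (1 - |\<zeta>|\<^sup>2) / (2 |F \<zeta>|)\<close> (\<open>deriv_norm_covering\<close>). The dichotomy holds because a bounded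
  set of singular values forces \<open>\<eta> = \<infinity>\<close>, while \<open>\<eta> \<noteq> 0\<close> forces the set of singular values to be bounded.

  Suppose that all values of modulus greater than \<open>R\<close> are regular. Then \<open>f\<close> acts as a covering over
  \<open>{|w| > R}\<close>, so \<open>exp\<close> lifts through \<open>f\<close>, with the value \<open>z\<close> at \<open>Ln (f z)\<close>, on each disc about
  \<open>Ln (f z)\<close> of radius \<open>\<rho> < ln |f z| - ln R\<close> (\<open>exp_lift_exists\<close>). This lift is an inverse of \<open>f\<close> in the
  coordinate for which the cylindrical metric is Euclidean, and by the Schwarz--Pick inequality its
  hyperbolic derivative at the centre is at most \<open>2/\<rho>\<close>. So the norm of \<open>Df\<close> at \<open>z\<close> is at least \<open>\<rho>/2\<close>
  (\<open>deriv_norm_ge_if_exp_lift\<close>), which tends to \<open>\<infinity>\<close> with \<open>|f z|\<close>.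

  Conversely, suppose that the norm of \<open>Df\<close> is at least \<open>\<kappa> > 0\<close> where \<open>|f| > R\<close>, with \<open>R \<ge> 1\<close>. Then inverse branches of
  \<open>F\<close> over \<open>{|w| > R}\<close> are Lipschitz maps into the hyperbolic disc. Continued along segments of bounded length they
  stay in a compact subset of the disc, where they can be continued by a uniform amount; hence, if \<open>|s| > R + 2\<close>, each germ of an
  inverse at a point of the unit disc about \<open>s\<close> extends to this disc (\<open>inverse_branch_if_expanding\<close>).
  Composed with \<open>p\<close>, these branches invert \<open>f\<close> on the components of the preimage of that disc, so \<open>s\<close>
  is a regular value (\<open>regular_value_if_expanding\<close>).

  Every continuation in the proof, including the lifting through \<open>p\<close>, is an instance of
  \<open>lift_exists_uniform\<close>: a lift through a locally injective map extends over a bounded convex set if it can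
  always be continued by a fixed distance.\<close>

section \<open>Lifts through locally injective maps\<close>

definition locally_injective_on :: "('a::topological_space \<Rightarrow> 'b) \<Rightarrow> 'a set \<Rightarrow> bool" where
  "locally_injective_on F T \<longleftrightarrow> (\<forall>x\<in>T. \<exists>N. open N \<and> x \<in> N \<and> inj_on F (T \<inter> N))"

text \<open>A lift of \<open>E\<close> through \<open>F\<close>. Base and total space are arbitrary topological spaces, because the
  surface need not lie in a normed space: lifts run from the plane to the surface (through \<open>f\<close>),
  from the plane to the disc (through \<open>f \<circ> p\<close> and \<open>p\<close>), and from the surface to itself.\<close>

definition is_lift ::
    "('b::topological_space \<Rightarrow> 'c) \<Rightarrow> 'b set \<Rightarrow> ('a::topological_space \<Rightarrow> 'c) \<Rightarrow> 'a set \<Rightarrow> ('a \<Rightarrow> 'b) \<Rightarrow> bool"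
  where "is_lift F T E S G \<longleftrightarrow> continuous_on S G \<and> G ` S \<subseteq> T \<and> (\<forall>x\<in>S. F (G x) = E x)"

lemma is_lift_subset: "is_lift F T E S G \<Longrightarrow> S' \<subseteq> S \<Longrightarrow> is_lift F T E S' G"
  unfolding is_lift_def by (meson continuous_on_subset image_mono subset_trans subsetD)

text \<open>The agreement set is open by local injectivity and closed by the Hausdorff property.\<close>

lemma lift_unique:
  fixes G H :: "'a::topological_space \<Rightarrow> 'b::t2_space"
  assumes S: "connected S" and F: "locally_injective_on F T"
    and G: "is_lift F T E S G" and H: "is_lift F T E S H"
    and a: "a \<in> S" "G a = H a" and x: "x \<in> S"
  shows "G x = H x"
proof -
  define Q where "Q = {x\<in>S. G x = H x}"
  have op: "openin (top_of_set S) (S \<inter> G -` U \<inter> (S \<inter> H -` V))" if "open U" "open V" for U V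
    using G H that unfolding is_lift_def
    by (intro openin_Int continuous_openin_preimage_gen) auto
  have "openin (top_of_set S) Q"
  proof (subst openin_subopen, intro ballI)
    fix y assume y: "y \<in> Q"
    then have "G y \<in> T" "y \<in> S" "G y = H y"
      using G by (auto simp: Q_def is_lift_def)
    with F obtain N where N: "open N" "G y \<in> N" "inj_on F (T \<inter> N)"
      unfolding locally_injective_on_def by blast
    show "\<exists>U. openin (top_of_set S) U \<and> y \<in> U \<and> U \<subseteq> Q"
    proof (intro exI conjI)
      show "S \<inter> G -` N \<inter> (S \<inter> H -` N) \<subseteq> Q"
      proof
        fix u assume u: "u \<in> S \<inter> G -` N \<inter> (S \<inter> H -` N)"
        then have "F (G u) = F (H u)" "G u \<in> T \<inter> N" "H u \<in> T \<inter> N"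
          using G H by (auto simp: is_lift_def)
        with N(3) u show "u \<in> Q" by (auto simp: Q_def dest: inj_onD)
      qed
    qed (use op[OF N(1) N(1)] N(2) \<open>y \<in> S\<close> \<open>G y = H y\<close> in auto)
  qed
  moreover have "openin (top_of_set S) (S - Q)"
  proof (subst openin_subopen, intro ballI)
    fix y assume y: "y \<in> S - Q"
    then have "G y \<noteq> H y" "y \<in> S" by (auto simp: Q_def)
    then obtain U V where UV: "open U" "open V" "G y \<in> U" "H y \<in> V" "U \<inter> V = {}"
      using hausdorff[of "G y" "H y"] by blast
    show "\<exists>U. openin (top_of_set S) U \<and> y \<in> U \<and> U \<subseteq> S - Q"
    proof (intro exI conjI)
      show "openin (top_of_set S) (S \<inter> G -` U \<inter> (S \<inter> H -` V))" by (rule op[OF UV(1,2)])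
      show "S \<inter> G -` U \<inter> (S \<inter> H -` V) \<subseteq> S - Q"
        using UV(5) unfolding Q_def by auto
    qed (use UV \<open>y \<in> S\<close> in auto)
  qed
  then have "closedin (top_of_set S) Q"
    by (auto simp: closedin_def Q_def)
  ultimately have "Q = {} \<or> Q = S"
    using S by (auto simp: connected_clopen)
  with a x show ?thesis by (auto simp: Q_def)
qed

text \<open>Analytic continuation with a uniform step. If each lift that starts at \<open>x0\<close> on a piece
  \<open>C \<inter> cball w0 \<rho>\<close> can be continued from every point of the piece by a distance \<open>\<delta>\<close> that does not
  depend on \<open>\<rho>\<close>, then these continuations glue to a lift on \<open>C \<inter> cball w0 (\<rho> + \<delta>/2)\<close>, and boundedness
  of \<open>C\<close> makes finitely many steps suffice. The hypothesis only speaks of values that such lifts can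
  take, so an a-priori bound on the lifts may be used to verify it.\<close>

lemma lift_exists_uniform:
  fixes F :: "'b::t2_space \<Rightarrow> 'c" and E :: "'a::real_normed_vector \<Rightarrow> 'c"
  assumes C: "convex C" "bounded C" "w0 \<in> C" and x0: "x0 \<in> T" "F x0 = E w0"
    and F: "locally_injective_on F T" and \<delta>: "0 < \<delta>"
    and step: "\<And>\<rho> G w. \<lbrakk>is_lift F T E (C \<inter> cball w0 \<rho>) G; G w0 = x0; w \<in> C \<inter> cball w0 \<rho>\<rbrakk>
                 \<Longrightarrow> \<exists>H. is_lift F T E (C \<inter> ball w \<delta>) H \<and> H w = G w"
  shows "\<exists>G. is_lift F T E C G \<and> G w0 = x0"
proof -
  have lifts: "\<exists>G. is_lift F T E (C \<inter> cball w0 (real n * (\<delta>/2))) G \<and> G w0 = x0" for n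
  proof (induction n)
    case 0
    have "C \<inter> cball w0 (real 0 * (\<delta>/2)) = {w0}" using C by auto
    then show ?case using x0 by (auto simp: is_lift_def intro!: exI[of _ "\<lambda>_. x0"])
  next
    case (Suc n)
    define \<rho> where "\<rho> = real n * (\<delta>/2)"
    have \<rho>: "0 \<le> \<rho>" "real (Suc n) * (\<delta>/2) = \<rho> + \<delta>/2" using \<delta> by (auto simp: \<rho>_def algebra_simps)
    define A where "A = C \<inter> cball w0 \<rho>"
    define A' where "A' = C \<inter> cball w0 (\<rho> + \<delta>/2)"
    have "convex A" "convex A'" "w0 \<in> A" using C \<rho> by (auto simp: A_def A'_def convex_Int)
    from Suc obtain G where G: "is_lift F T E A G" "G w0 = x0"
      by (auto simp: A_def \<rho>_def)
    have "\<forall>w\<in>A. \<exists>H. is_lift F T E (C \<inter> ball w \<delta>) H \<and> H w = G w"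
      using step[of \<rho> G] G by (auto simp: A_def)
    then obtain H where H: "\<And>w. w \<in> A \<Longrightarrow> is_lift F T E (C \<inter> ball w \<delta>) (H w)"
        "\<And>w. w \<in> A \<Longrightarrow> H w w = G w"
      by metis
    have HG: "H w u = G u" if "w \<in> A" "u \<in> A" "dist w u < \<delta>" for w u
    proof (rule lift_unique[where S = "A \<inter> ball w \<delta>"])
      show "connected (A \<inter> ball w \<delta>)"
        using \<open>convex A\<close> by (intro convex_connected convex_Int) auto
    qed (use H[OF that(1)] that G F \<delta> in \<open>auto intro: is_lift_subset simp: A_def\<close>)
    have HH: "H v u = H w u" if vw: "v \<in> A" "w \<in> A" and u: "u \<in> C" "dist v u < \<delta>" "dist w u < \<delta>" for v w u
    proof -
      \<comment> \<open>Two continuations are compared at the midpoint of their centres: it lies in the convex set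
        \<open>A\<close>, where both agree with \<open>G\<close>, and in the intersection of their domains.\<close>
      have "midpoint v w \<in> A"
        using \<open>convex A\<close> vw closed_segment_subset midpoint_in_closed_segment by blast
      have "dist v w < 2 * \<delta>" using u dist_triangle2[of v w u] by linarith
      then have m: "dist v (midpoint v w) < \<delta>" "dist w (midpoint v w) < \<delta>"
        by (simp_all add: dist_midpoint)
      show ?thesis
      proof (rule lift_unique[where S = "C \<inter> (ball v \<delta> \<inter> ball w \<delta>)"])
        show "connected (C \<inter> (ball v \<delta> \<inter> ball w \<delta>))"
          using C by (intro convex_connected convex_Int) auto
        show "H v (midpoint v w) = H w (midpoint v w)"
          using HG \<open>midpoint v w \<in> A\<close> vw m by simp
      qed (use H vw F u m \<open>midpoint v w \<in> A\<close> in \<open>auto intro: is_lift_subset simp: A_def\<close>)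
    qed
    have cover: "\<exists>w\<in>A. dist w u < \<delta>" if u: "u \<in> A'" for u
    proof (cases "u \<in> A")
      case False
      define d where "d = dist w0 u"
      have d: "\<rho> < d" "d \<le> \<rho> + \<delta>/2" using u False by (auto simp: A_def A'_def d_def)
      define w where "w = w0 + (\<rho>/d) *\<^sub>R (u - w0)"
      have eq: "w = (1 - \<rho>/d) *\<^sub>R w0 + (\<rho>/d) *\<^sub>R u"
        by (simp add: w_def algebra_simps)
      have "w \<in> C" unfolding eq
        using C u d \<rho> by (intro convexD) (auto simp: A'_def field_simps)
      moreover have "dist w0 w = \<rho>"
        using d \<rho> by (auto simp: w_def dist_norm d_def norm_minus_commute)
      moreover have "dist w u = d - \<rho>"
      proof -
        have "w - u = (1 - \<rho>/d) *\<^sub>R (w0 - u)" by (simp add: eq algebra_simps)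
        then have "dist w u = (1 - \<rho>/d) * d"
          using d \<rho> by (simp add: dist_norm d_def divide_le_eq)
        then show ?thesis using d \<rho> by (simp add: left_diff_distrib)
      qed
      ultimately show ?thesis using d \<delta> by (intro bexI[of _ w]) (auto simp: A_def)
    qed (use \<delta> in force)
    have "\<exists>g. continuous_map (top_of_set A') (top_of_set T) g \<and>
          (\<forall>x i. i \<in> A \<longrightarrow> x \<in> A' \<inter> ball i \<delta> \<longrightarrow> g x = H i x)"
    proof (rule pasting_lemma_exists[where I = A and T = "\<lambda>i. A' \<inter> ball i \<delta>" and f = H
             and X = "top_of_set A'" and Y = "top_of_set T"])
      show "topspace (top_of_set A') \<subseteq> (\<Union>i\<in>A. A' \<inter> ball i \<delta>)" using cover by auto
      show "openin (top_of_set A') (A' \<inter> ball i \<delta>)" for i by (simp add: openin_open_Int)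
      show "continuous_map (subtopology (top_of_set A') (A' \<inter> ball i \<delta>)) (top_of_set T) (H i)"
        if "i \<in> A" for i
        using is_lift_subset[OF H(1)[OF that], of "A' \<inter> ball i \<delta>"]
        by (auto simp: subtopology_subtopology continuous_map_subtopology_eu is_lift_def A'_def)
      show "H i x = H j x" if "i \<in> A" "j \<in> A" "x \<in> topspace (top_of_set A') \<inter> (A' \<inter> ball i \<delta>) \<inter> (A' \<inter> ball j \<delta>)"
        for i j x using that HH[of i j x] by (auto simp: A'_def)
    qed auto
    then obtain g where g: "continuous_on A' g" "g ` A' \<subseteq> T"
        and gH: "\<And>x i. i \<in> A \<Longrightarrow> x \<in> A' \<Longrightarrow> dist i x < \<delta> \<Longrightarrow> g x = H i x"
      by (auto simp: continuous_map_subtopology_eu)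
    have "is_lift F T E A' g"
      unfolding is_lift_def
    proof (intro conjI ballI)
      fix u assume u: "u \<in> A'"
      with cover obtain w where w: "w \<in> A" "dist w u < \<delta>" by blast
      then show "F (g u) = E u"
        using gH[OF w(1) u w(2)] H(1)[OF w(1)] u by (auto simp: is_lift_def A'_def)
    qed (use g in auto)
    moreover have "g w0 = x0"
      using gH[of w0 w0] H(2)[of w0] \<open>w0 \<in> A\<close> \<delta> G \<rho> C by (auto simp: A'_def)
    ultimately show ?case unfolding \<rho> A'_def by blast
  qed
  obtain B where B: "\<And>w. w \<in> C \<Longrightarrow> dist w0 w \<le> B"
    using C by (auto simp: bounded_any_center[of _ w0])
  obtain n where "B / (\<delta>/2) < real n" using reals_Archimedean2 by blast
  then have "B \<le> real n * (\<delta>/2)" using \<delta> by (simp add: field_simps)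
  then have "C \<inter> cball w0 (real n * (\<delta>/2)) = C" using B by force
  with lifts[of n] show ?thesis by simp
qed

text \<open>On a compact convex set, local liftability with arbitrary initial values, as a covering map
  provides it, is uniform by the Lebesgue number argument.\<close>

lemma lift_exists_compact:
  fixes F :: "'b::t2_space \<Rightarrow> 'c" and E :: "'a::real_normed_vector \<Rightarrow> 'c"
  assumes C: "convex C" "compact C" "w0 \<in> C" and x0: "x0 \<in> T" "F x0 = E w0"
    and F: "locally_injective_on F T"
    and loc: "\<And>w. w \<in> C \<Longrightarrow> \<exists>N. open N \<and> w \<in> N \<and>
               (\<forall>v\<in>C \<inter> N. \<forall>x\<in>T. F x = E v \<longrightarrow> (\<exists>H. is_lift F T E (C \<inter> N) H \<and> H v = x))"
  shows "\<exists>G. is_lift F T E C G \<and> G w0 = x0"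
proof -
  define \<N> where "\<N> = {N. open N \<and>
     (\<forall>v\<in>C \<inter> N. \<forall>x\<in>T. F x = E v \<longrightarrow> (\<exists>H. is_lift F T E (C \<inter> N) H \<and> H v = x))}"
  have "C \<subseteq> \<Union>\<N>" using loc by (fastforce simp: \<N>_def)
  moreover have "\<And>N. N \<in> \<N> \<Longrightarrow> open N" by (simp add: \<N>_def)
  ultimately obtain \<delta> where \<delta>: "0 < \<delta>" "\<And>w. w \<in> C \<Longrightarrow> \<exists>N\<in>\<N>. ball w \<delta> \<subseteq> N"
    using Heine_Borel_lemma[OF C(2)] by metis
  show ?thesis
  proof (rule lift_exists_uniform[where \<delta> = \<delta>])
    show "bounded C" using C compact_imp_bounded by blast
    fix \<rho> G w assume G: "is_lift F T E (C \<inter> cball w0 \<rho>) G" and w: "w \<in> C \<inter> cball w0 \<rho>"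
    obtain N where N: "N \<in> \<N>" "ball w \<delta> \<subseteq> N" using \<delta> w by blast
    have "G w \<in> T" "F (G w) = E w" using G w by (auto simp: is_lift_def)
    moreover have "w \<in> C \<inter> N" using w N \<delta>(1) by auto
    ultimately obtain H where "is_lift F T E (C \<inter> N) H" "H w = G w"
      using N(1) by (fastforce simp: \<N>_def)
    then show "\<exists>H. is_lift F T E (C \<inter> ball w \<delta>) H \<and> H w = G w"
      using N(2) by (meson Int_mono is_lift_subset order_refl)
  qed (use C x0 F \<delta> in auto)
qed

section \<open>Lifts through conformal maps and the Schwarz--Pick inequality\<close>

lemma local_inverse_branch:
  assumes "F holomorphic_on U" "open U" "\<zeta> \<in> U" "deriv F \<zeta> \<noteq> 0"
  obtains N \<Psi> where "open N" "\<zeta> \<in> N" "N \<subseteq> U" "inj_on F N" "open (F ` N)" "\<Psi> holomorphic_on F ` N"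
    "\<And>z. z \<in> N \<Longrightarrow> \<Psi> (F z) = z" "(\<Psi> has_field_derivative 1 / deriv F \<zeta>) (at (F \<zeta>))"
proof -
  obtain r where r: "r > 0" "ball \<zeta> r \<subseteq> U" "open (F ` ball \<zeta> r)" "inj_on F (ball \<zeta> r)"
    using has_complex_derivative_locally_invertible[OF assms(1,3,2,4)] by blast
  have hol: "F holomorphic_on ball \<zeta> r" using assms(1) r(2) by (rule holomorphic_on_subset)
  obtain \<Psi> where \<Psi>: "\<Psi> holomorphic_on F ` ball \<zeta> r"
      "\<And>z. z \<in> ball \<zeta> r \<Longrightarrow> deriv F z * deriv \<Psi> (F z) = 1" "\<And>z. z \<in> ball \<zeta> r \<Longrightarrow> \<Psi> (F z) = z"
    using holomorphic_has_inverse[OF hol open_ball r(4)] by blast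
  have "\<zeta> \<in> ball \<zeta> r" using r by simp
  then have "deriv \<Psi> (F \<zeta>) = 1 / deriv F \<zeta>" using \<Psi>(2)[of \<zeta>] assms(4) by (simp add: field_simps)
  moreover have "(\<Psi> has_field_derivative deriv \<Psi> (F \<zeta>)) (at (F \<zeta>))"
    using \<Psi>(1) r(3) \<open>\<zeta> \<in> ball \<zeta> r\<close> by (intro holomorphic_derivI) auto
  ultimately show ?thesis using that[of "ball \<zeta> r" \<Psi>] r \<Psi> by simp
qed

text \<open>Near \<open>x\<close> the lift is a local inverse of \<open>F\<close> after \<open>E\<close>. The domain is a general normed space, so
  that this covers both holomorphic lifts and lifts of real curves.\<close>

lemma lift_has_derivative:
  fixes \<phi> :: "'a::real_normed_vector \<Rightarrow> complex"
  assumes F: "F holomorphic_on U" "open U" "\<phi> x \<in> U" "deriv F (\<phi> x) \<noteq> 0"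
    and \<phi>: "continuous_on S \<phi>" "x \<in> S"
    and E: "(E has_derivative D) (at x within S)" "\<And>y. y \<in> S \<Longrightarrow> F (\<phi> y) = E y"
  shows "(\<phi> has_derivative (\<lambda>h. D h / deriv F (\<phi> x))) (at x within S)"
proof -
  obtain N \<Psi> where N: "open N" "\<phi> x \<in> N" "\<And>z. z \<in> N \<Longrightarrow> \<Psi> (F z) = z"
      "(\<Psi> has_field_derivative 1 / deriv F (\<phi> x)) (at (F (\<phi> x)))"
    using local_inverse_branch[OF F] by metis
  have "openin (top_of_set S) (S \<inter> \<phi> -` N)"
    using \<phi> N by (intro continuous_openin_preimage_gen)
  moreover have "x \<in> S \<inter> \<phi> -` N" using N(2) \<phi>(2) by simp
  ultimately obtain d where d: "0 < d" "ball x d \<inter> S \<subseteq> S \<inter> \<phi> -` N"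
    unfolding openin_contains_ball by blast
  have "((\<lambda>y. \<Psi> (E y)) has_derivative (\<lambda>h. 1 / deriv F (\<phi> x) * D h)) (at x within S)"
    using N(4) unfolding E(2)[OF \<phi>(2)] has_field_derivative_def
    by (rule has_derivative_compose[OF E(1)])
  then have "(\<phi> has_derivative (\<lambda>h. 1 / deriv F (\<phi> x) * D h)) (at x within S)"
  proof (rule has_derivative_transform_within[OF _ d(1) \<phi>(2)])
    fix y assume y: "y \<in> S" "dist y x < d"
    then have "\<phi> y \<in> N" using d(2) by (auto simp: dist_commute)
    then show "\<Psi> (E y) = \<phi> y" using E(2) N(3) y by metis
  qed
  then show ?thesis by (simp add: field_simps)
qed

lemma lift_holomorphic:
  assumes F: "F holomorphic_on U" "open U" "\<And>x. x \<in> S \<Longrightarrow> \<phi> x \<in> U" "\<And>x. x \<in> S \<Longrightarrow> deriv F (\<phi> x) \<noteq> 0"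
    and S: "open S" and \<phi>: "continuous_on S \<phi>"
    and E: "E holomorphic_on S" "\<And>y. y \<in> S \<Longrightarrow> F (\<phi> y) = E y"
  shows "\<phi> holomorphic_on S"
proof (rule holomorphic_onI)
  fix x assume x: "x \<in> S"
  have "(E has_field_derivative deriv E x) (at x within S)"
    using holomorphic_derivI[OF E(1) S x] by (rule has_field_derivative_at_within)
  then have "(E has_derivative ((*) (deriv E x))) (at x within S)"
    by (simp add: has_field_derivative_def)
  from lift_has_derivative[OF F(1,2) F(3)[OF x] F(4)[OF x] \<phi> x this E(2)]
  have "(\<phi> has_field_derivative deriv E x / deriv F (\<phi> x)) (at x within S)"
    unfolding has_field_derivative_def by (rule has_derivative_eq_rhs) (auto simp: field_simps)
  then show "\<phi> field_differentiable (at x within S)"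
    by (auto simp: field_differentiable_def)
qed

lemma deriv_Moebius_function:
  assumes "cnj a * z \<noteq> 1"
  shows "(Moebius_function 0 a has_field_derivative (1 - cnj a * a) / (1 - cnj a * z)\<^sup>2) (at z)"
proof -
  have "((\<lambda>z. (z - a) / (1 - cnj a * z)) has_field_derivative (1 - cnj a * a) / (1 - cnj a * z)\<^sup>2) (at z)"
    using assms by (auto intro!: derivative_eq_intros simp: power2_eq_square) (auto simp: algebra_simps)
  then show ?thesis by (simp add: Moebius_function_simple[abs_def])
qed

text \<open>The Schwarz lemma, after normalising the domain by an affine map and the value at the centre by a
  Moebius map.\<close>

lemma Schwarz_Pick_ball:
  assumes g: "g holomorphic_on ball w0 \<rho>" "g ` ball w0 \<rho> \<subseteq> ball 0 1" and \<rho>: "0 < \<rho>"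
  shows "cmod (deriv g w0) * \<rho> \<le> 1 - (cmod (g w0))\<^sup>2"
proof -
  define a where "a = g w0"
  have a: "cmod a < 1" using g(2) \<rho> by (force simp: a_def)
  then have a1: "1 - (cmod a)\<^sup>2 > 0" by (simp add: power_less_one_iff abs_square_less_1)
  have aa: "cnj a * a = of_real ((cmod a)\<^sup>2)" using complex_norm_square[of a] by (simp add: mult.commute)
  define l where "l = (\<lambda>u. w0 + of_real \<rho> * u)"
  have l: "l u \<in> ball w0 \<rho>" if "u \<in> ball 0 1" for u
    using that \<rho> by (simp add: l_def dist_norm norm_mult)
  define h where "h = (\<lambda>u. Moebius_function 0 a (g (l u)))"
  have gl: "(\<lambda>u. g (l u)) holomorphic_on ball 0 1"
  proof (rule holomorphic_on_compose_gen[unfolded o_def, OF _ g(1)])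
    show "l holomorphic_on ball 0 1" unfolding l_def by (intro holomorphic_intros)
    show "l ` ball 0 1 \<subseteq> ball w0 \<rho>" using l by blast
  qed
  have glb: "cmod (g (l u)) < 1" if "cmod u < 1" for u using g(2) l[of u] that by (simp add: image_subset_iff)
  have "h holomorphic_on ball 0 1"
    unfolding h_def using glb
    by (intro holomorphic_on_compose_gen[unfolded o_def, OF gl Moebius_function_holomorphic[OF a]]) auto
  moreover have "h 0 = 0" by (simp add: h_def l_def a_def Moebius_function_eq_zero)
  moreover have "cmod (h z) < 1" if "cmod z < 1" for z
    unfolding h_def using a glb[OF that] by (rule Moebius_function_norm_lt_1)
  ultimately have le: "cmod (deriv h 0) \<le> 1" using Schwarz_Lemma(2)[of h 0] by simp
  have "(g has_field_derivative deriv g w0) (at (l 0))"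
    using g \<rho> by (simp add: l_def holomorphic_derivI[of g "ball w0 \<rho>"])
  moreover have "(l has_field_derivative of_real \<rho>) (at 0)"
    unfolding l_def by (auto intro!: derivative_eq_intros)
  ultimately have d1: "((\<lambda>u. g (l u)) has_field_derivative deriv g w0 * of_real \<rho>) (at 0)"
    using DERIV_chain2 by blast
  have "cnj a * a \<noteq> 1" using a1 unfolding aa by (metis diff_self of_real_eq_1_iff less_irrefl)
  then have "(Moebius_function 0 a has_field_derivative 1 / (1 - cnj a * a)) (at (g (l 0)))"
    using deriv_Moebius_function[of a a] by (simp add: l_def a_def power2_eq_square)
  from DERIV_chain2[OF this d1]
  have "deriv h 0 = deriv g w0 * of_real \<rho> / (1 - cnj a * a)"
    unfolding h_def by (simp add: DERIV_imp_deriv)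
  also have "cmod \<dots> = cmod (deriv g w0) * \<rho> / (1 - (cmod a)\<^sup>2)"
  proof -
    have "1 - cnj a * a = of_real (1 - (cmod a)\<^sup>2)" unfolding aa by simp
    then have "cmod (1 - cnj a * a) = 1 - (cmod a)\<^sup>2" using a1 by (simp only: norm_of_real)
    then show ?thesis using \<rho> by (simp add: norm_divide norm_mult)
  qed
  finally show ?thesis using le a1 by (simp add: a_def divide_le_eq)
qed

section \<open>Charts and coverings\<close>

lemma chart_facts:
  assumes "riemann_surface X A" "c \<in> A"
  shows "openin (top_of_set X) (fst c)" "fst c \<subseteq> X" "open (snd c ` fst c)"
    "continuous_on (fst c) (snd c)" "continuous_on (snd c ` fst c) (chart_inv c)"
    "\<And>z. z \<in> fst c \<Longrightarrow> chart_inv c (snd c z) = z"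
    "\<And>W. openin (top_of_set X) W \<Longrightarrow> open (snd c ` (fst c \<inter> W))"
    "\<And>V. open V \<Longrightarrow> openin (top_of_set X) (fst c \<inter> snd c -` V)"
proof -
  have c: "openin (top_of_set X) (fst c)" "open (snd c ` fst c)"
    "homeomorphism (fst c) (snd c ` fst c) (snd c) (chart_inv c)"
    using assms by (auto simp: riemann_surface_def complex_chart_on_def)
  then show "openin (top_of_set X) (fst c)" "fst c \<subseteq> X" "open (snd c ` fst c)"
    "continuous_on (fst c) (snd c)" "continuous_on (snd c ` fst c) (chart_inv c)"
    "\<And>z. z \<in> fst c \<Longrightarrow> chart_inv c (snd c z) = z"
    by (auto simp: homeomorphism_def dest: openin_imp_subset)
  show "open (snd c ` (fst c \<inter> W))" if W: "openin (top_of_set X) W" for W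
  proof -
    have "openin (top_of_set (fst c)) (fst c \<inter> W)"
      using W \<open>fst c \<subseteq> X\<close> by (fastforce simp: openin_open)
    then have "openin (top_of_set (snd c ` fst c)) (snd c ` (fst c \<inter> W))"
      using c(3) homeomorphism_imp_open_map by blast
    then show ?thesis using c(2) openin_open_eq by blast
  qed
  show "openin (top_of_set X) (fst c \<inter> snd c -` V)" if "open V" for V
    using continuous_openin_preimage_gen[OF \<open>continuous_on (fst c) (snd c)\<close> that] c(1) openin_trans
    by blast
qed

lemma chart_at_facts:
  assumes "riemann_surface X A" "z \<in> X"
  shows "chart_at A z \<in> A" "z \<in> fst (chart_at A z)"
proof -
  have "\<exists>c. c \<in> A \<and> z \<in> fst c" using assms by (auto simp: riemann_surface_def)
  then have "chart_at A z \<in> A \<and> z \<in> fst (chart_at A z)"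
    unfolding chart_at_def by (rule someI_ex)
  then show "chart_at A z \<in> A" "z \<in> fst (chart_at A z)" by auto
qed

lemma analytic_in_chart:
  assumes "riemann_surface X A" "analytic_to_plane A f X" "c \<in> A"
  shows "(f \<circ> chart_inv c) holomorphic_on snd c ` fst c"
  using assms chart_facts(2)[OF assms(1,3)] by (auto simp: analytic_to_plane_def Int_absorb2)

lemma analytic_to_plane_continuous:
  assumes X: "riemann_surface X A" and f: "analytic_to_plane A f X"
  shows "continuous_on X f"
  unfolding continuous_openin_preimage_eq
proof (intro allI impI)
  fix T :: "complex set" assume T: "open T"
  show "openin (top_of_set X) (X \<inter> f -` T)"
  proof (subst openin_subopen, intro ballI)
    fix z assume z: "z \<in> X \<inter> f -` T"
    define c where "c = chart_at A z"
    have c: "c \<in> A" "z \<in> fst c" using chart_at_facts[OF X] z by (auto simp: c_def)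
    note cf = chart_facts[OF X c(1)]
    have "continuous_on (fst c) ((f \<circ> chart_inv c) \<circ> snd c)"
      using analytic_in_chart[OF X f c(1)] cf(4)
      by (intro continuous_on_compose holomorphic_on_imp_continuous_on)
    then have "continuous_on (fst c) f"
      by (rule continuous_on_eq) (simp add: cf(6))
    then have "openin (top_of_set (fst c)) (fst c \<inter> f -` T)"
      using T by (rule continuous_openin_preimage_gen)
    then have "openin (top_of_set X) (fst c \<inter> f -` T)" using cf(1) openin_trans by blast
    then show "\<exists>S. openin (top_of_set X) S \<and> z \<in> S \<and> S \<subseteq> X \<inter> f -` T"
      using c z cf(2) by (intro exI[of _ "fst c \<inter> f -` T"]) auto
  qed
qed

lemma chart_deriv_nonzero_if_injective:
  assumes X: "riemann_surface X A" and f: "analytic_to_plane A f X" and c: "c \<in> A" "z \<in> fst c"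
    and W: "openin (top_of_set X) W" "z \<in> W" "inj_on f W"
  shows "deriv (f \<circ> chart_inv c) (snd c z) \<noteq> 0"
proof (rule holomorphic_injective_imp_regular)
  note cf = chart_facts[OF X c(1)]
  show "(f \<circ> chart_inv c) holomorphic_on snd c ` (fst c \<inter> W)"
    using analytic_in_chart[OF X f c(1)] by (rule holomorphic_on_subset) auto
  show "open (snd c ` (fst c \<inter> W))" using cf(7) W by blast
  show "inj_on (f \<circ> chart_inv c) (snd c ` (fst c \<inter> W))"
    using W(3) by (auto simp: inj_on_def cf(6))
qed (use c W in auto)

lemma locally_injective_if_chart_deriv_nonzero:
  assumes X: "riemann_surface X A" and f: "analytic_to_plane A f X" and T: "T \<subseteq> X"
    and d: "\<And>z. z \<in> T \<Longrightarrow> \<exists>c\<in>A. z \<in> fst c \<and> deriv (f \<circ> chart_inv c) (snd c z) \<noteq> 0"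
  shows "locally_injective_on f T"
  unfolding locally_injective_on_def
proof
  fix z assume z: "z \<in> T"
  then obtain c where c: "c \<in> A" "z \<in> fst c" "deriv (f \<circ> chart_inv c) (snd c z) \<noteq> 0"
    using d by blast
  note cf = chart_facts[OF X c(1)]
  obtain r where r: "r > 0" "inj_on (f \<circ> chart_inv c) (ball (snd c z) r)"
    using has_complex_derivative_locally_injective[OF analytic_in_chart[OF X f c(1)] _ cf(3) c(3)] c(2)
    by blast
  obtain N where N: "open N" "fst c \<inter> snd c -` ball (snd c z) r = X \<inter> N"
    using cf(8)[OF open_ball, of "snd c z" r] by (auto simp: openin_open)
  have "inj_on f (T \<inter> N)"
  proof (rule inj_onI)
    fix x y assume xy: "x \<in> T \<inter> N" "y \<in> T \<inter> N" "f x = f y"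
    then have m: "x \<in> fst c \<inter> snd c -` ball (snd c z) r" "y \<in> fst c \<inter> snd c -` ball (snd c z) r"
      using T N(2) by blast+
    then have "(f \<circ> chart_inv c) (snd c x) = (f \<circ> chart_inv c) (snd c y)"
      using xy(3) by (simp add: cf(6))
    moreover have "snd c x \<in> ball (snd c z) r" "snd c y \<in> ball (snd c z) r" using m by blast+
    ultimately have "snd c x = snd c y" by (rule inj_onD[OF r(2)])
    then show "x = y" using m cf(6) by (metis IntD1)
  qed
  moreover have "z \<in> N" using N(2) c(2) r(1) by auto
  ultimately show "\<exists>N. open N \<and> z \<in> N \<and> inj_on f (T \<inter> N)" using N(1) by blast
qed

text \<open>Charts make a surface locally connected; hence components of open sets are neighbourhoods of
  their points.\<close>

lemma connected_neighbourhood_in_surface: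
  assumes X: "riemann_surface X A" and W: "openin (top_of_set X) W" "z \<in> W"
  obtains N where "openin (top_of_set X) N" "z \<in> N" "connected N" "N \<subseteq> W"
proof -
  have zX: "z \<in> X" using W openin_imp_subset by blast
  define c where "c = chart_at A z"
  have c: "c \<in> A" "z \<in> fst c" using chart_at_facts[OF X zX] by (auto simp: c_def)
  note cf = chart_facts[OF X c(1)]
  have "open (snd c ` (fst c \<inter> W))" "snd c z \<in> snd c ` (fst c \<inter> W)" using cf(7) W c by auto
  then obtain r where r: "r > 0" "ball (snd c z) r \<subseteq> snd c ` (fst c \<inter> W)"
    by (meson openE)
  define N where "N = fst c \<inter> snd c -` ball (snd c z) r"
  have eq: "N = chart_inv c ` ball (snd c z) r"
    using r(2) cf(6) by (auto simp: N_def image_iff) (metis mem_ball)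
  show ?thesis
  proof
    show "openin (top_of_set X) N" unfolding N_def by (rule cf(8)) simp
    show "z \<in> N" using c r by (simp add: N_def)
    show "connected N" unfolding eq
      using r(2) by (intro connected_continuous_image continuous_on_subset[OF cf(5)]) auto
    show "N \<subseteq> W"
    proof
      fix y assume y: "y \<in> N"
      then obtain y' where "y' \<in> fst c \<inter> W" "snd c y = snd c y'" using r(2) by (force simp: N_def)
      then show "y \<in> W" using y cf(6) by (metis IntD1 IntD2 N_def)
    qed
  qed
qed

lemma covering_map_locally_injective:
  assumes "covering_space D p X"
  shows "locally_injective_on p D"
  unfolding locally_injective_on_def
proof
  fix x assume "x \<in> D"
  obtain T u q where "x \<in> T" "openin (top_of_set D) T" "p x \<in> u" "openin (top_of_set X) u"
      "homeomorphism T u p q"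
    using covering_space_local_homeomorphism[OF assms \<open>x \<in> D\<close>] by metis
  then show "\<exists>N. open N \<and> x \<in> N \<and> inj_on p (D \<inter> N)"
    by (auto simp: openin_open homeomorphism_def intro: inj_on_inverseI)
qed

text \<open>The lifting theorem for covering spaces, with a base that is an arbitrary topological space;
  compact convex domains are enough here.\<close>

lemma covering_lift_exists:
  fixes p :: "'b::t2_space \<Rightarrow> 'c::topological_space" and E :: "'a::real_normed_vector \<Rightarrow> 'c"
  assumes p: "covering_space D p X" and C: "convex C" "compact C" "w0 \<in> C"
    and E: "continuous_on C E" "E ` C \<subseteq> X" and x0: "x0 \<in> D" "p x0 = E w0"
  shows "\<exists>G. is_lift p D E C G \<and> G w0 = x0"
proof (rule lift_exists_compact[where F = p and E = E, OF C x0 covering_map_locally_injective[OF p]])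
  fix w assume w: "w \<in> C"
  then have "E w \<in> X" using E by blast
  then obtain T \<V> where T: "E w \<in> T" "openin (top_of_set X) T" "\<Union>\<V> = D \<inter> p -` T"
      "\<And>V. V \<in> \<V> \<Longrightarrow> \<exists>q. homeomorphism V T p q"
    using p unfolding covering_space_def by meson
  have "openin (top_of_set C) (C \<inter> E -` T)"
    using E T(2) by (intro continuous_openin_preimage[where T = X]) auto
  then obtain N where N: "open N" "C \<inter> E -` T = C \<inter> N" by (auto simp: openin_open)
  show "\<exists>N. open N \<and> w \<in> N \<and>
          (\<forall>v\<in>C \<inter> N. \<forall>x\<in>D. p x = E v \<longrightarrow> (\<exists>H. is_lift p D E (C \<inter> N) H \<and> H v = x))"
  proof (intro exI[of _ N] conjI ballI impI)
    show "w \<in> N" using N w T by blast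
    fix v x assume v: "v \<in> C \<inter> N" and x: "x \<in> D" "p x = E v"
    then have "E v \<in> T" using N by blast
    with x have "x \<in> \<Union>\<V>" unfolding T(3) by simp
    then obtain V where V: "V \<in> \<V>" "x \<in> V" by blast
    then obtain q where q: "homeomorphism V T p q" using T(4) by blast
    have ET: "E ` (C \<inter> N) \<subseteq> T" using N by blast
    have "V \<subseteq> D" using V T(3) by blast
    have "is_lift p D E (C \<inter> N) (q \<circ> E)"
      unfolding is_lift_def
    proof (intro conjI ballI)
      show "continuous_on (C \<inter> N) (q \<circ> E)"
        using E ET q by (intro continuous_on_compose)
          (auto intro: continuous_on_subset simp: homeomorphism_def)
      show "(q \<circ> E) ` (C \<inter> N) \<subseteq> D" using q ET \<open>V \<subseteq> D\<close> by (fastforce simp: homeomorphism_def)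
      show "p ((q \<circ> E) u) = E u" if "u \<in> C \<inter> N" for u
        using q ET that by (auto simp: homeomorphism_def)
    qed
    moreover have "(q \<circ> E) v = x" using q V x by (metis comp_apply homeomorphism_def)
    ultimately show "\<exists>H. is_lift p D E (C \<inter> N) H \<and> H v = x" by blast
  qed (use N in auto)
qed

section \<open>The hyperbolic density\<close>

lemma analytic_from_plane_subset:
  assumes "analytic_from_plane A g U" "V \<subseteq> U"
  shows "analytic_from_plane A g V"
  unfolding analytic_from_plane_def
proof (intro conjI ballI)
  show "continuous_on V g"
    using assms by (auto simp: analytic_from_plane_def intro: continuous_on_subset)
  show "(snd c \<circ> g) holomorphic_on {w\<in>V. g w \<in> fst c}" if "c \<in> A" for c
    by (rule holomorphic_on_subset[of _ "{w\<in>U. g w \<in> fst c}"])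
      (use assms that in \<open>auto simp: analytic_from_plane_def\<close>)
qed

lemma analytic_from_plane_in_chart:
  assumes X: "riemann_surface X A" and c: "c \<in> A"
    and g: "analytic_from_plane A g U" "g ` U \<subseteq> X" "open U"
  shows "open {w\<in>U. g w \<in> fst c}" "(snd c \<circ> g) holomorphic_on {w\<in>U. g w \<in> fst c}"
proof -
  have "openin (top_of_set U) (U \<inter> g -` fst c)"
    using g chart_facts(1)[OF X c] unfolding analytic_from_plane_def
    by (intro continuous_openin_preimage[where T = X]) auto
  moreover have "U \<inter> g -` fst c = {w\<in>U. g w \<in> fst c}" by auto
  ultimately show "open {w\<in>U. g w \<in> fst c}" using g(3) openin_open_eq by metis
  show "(snd c \<circ> g) holomorphic_on {w\<in>U. g w \<in> fst c}"
    using g c by (auto simp: analytic_from_plane_def)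
qed

lemma disc_covering_facts:
  assumes "disc_covering X A p"
  shows "covering_space (ball 0 1) p X" "analytic_from_plane A p (ball 0 1)" "p ` ball 0 1 = X"
    "locally_injective_on p (ball 0 1)"
  using assms covering_space_imp_surjective covering_map_locally_injective
  unfolding disc_covering_def by blast+

lemma covering_deriv_nonzero:
  assumes X: "riemann_surface X A" and p: "disc_covering X A p"
    and c: "c \<in> A" "\<zeta> \<in> ball 0 1" "p \<zeta> \<in> fst c"
  shows "deriv (snd c \<circ> p) \<zeta> \<noteq> 0"
proof -
  note pf = disc_covering_facts[OF p]
  note pc = analytic_from_plane_in_chart[OF X c(1) pf(2) _ open_ball]
  obtain N where N: "open N" "\<zeta> \<in> N" "inj_on p (ball 0 1 \<inter> N)"
    using pf(4) c(2) unfolding locally_injective_on_def by blast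
  define S where "S = {w\<in>ball 0 1. p w \<in> fst c} \<inter> N"
  show ?thesis
  proof (rule holomorphic_injective_imp_regular)
    show "(snd c \<circ> p) holomorphic_on S"
      using pc(2) pf(3) by (auto simp: S_def intro: holomorphic_on_subset)
    show "open S" using pc(1) pf(3) N(1) by (auto simp: S_def)
    show "inj_on (snd c \<circ> p) S"
    proof (rule inj_onI)
      fix x y assume xy: "x \<in> S" "y \<in> S" "(snd c \<circ> p) x = (snd c \<circ> p) y"
      then have "p x = p y"
        using chart_facts(6)[OF X c(1)] by (metis (lifting) S_def IntD1 comp_apply mem_Collect_eq)
      then show "x = y" using xy by (intro inj_onD[OF N(3)]) (auto simp: S_def)
    qed
    show "\<zeta> \<in> S" using c N by (auto simp: S_def)
  qed
qed

lemma lift_to_disc_holomorphic: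
  assumes X: "riemann_surface X A" and p: "disc_covering X A p"
    and U: "open U" and \<phi>: "analytic_from_plane A \<phi> U" "\<phi> ` U \<subseteq> X"
    and G: "is_lift p (ball 0 1) \<phi> U G"
  shows "G holomorphic_on U"
    and "\<And>c w. c \<in> A \<Longrightarrow> w \<in> U \<Longrightarrow> \<phi> w \<in> fst c \<Longrightarrow>
           deriv (snd c \<circ> \<phi>) w = deriv (snd c \<circ> p) (G w) * deriv G w"
proof -
  note pf = disc_covering_facts[OF p]
  have G': "continuous_on U G" "\<And>w. w \<in> U \<Longrightarrow> G w \<in> ball 0 1" "\<And>w. w \<in> U \<Longrightarrow> p (G w) = \<phi> w"
    using G by (auto simp: is_lift_def)
  have hol: "G holomorphic_on {w\<in>U. \<phi> w \<in> fst c}" if c: "c \<in> A" for c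
  proof (rule lift_holomorphic[where F = "snd c \<circ> p" and E = "snd c \<circ> \<phi>"])
    note pc = analytic_from_plane_in_chart[OF X c pf(2) _ open_ball]
    show "(snd c \<circ> p) holomorphic_on {w\<in>ball 0 1. p w \<in> fst c}" "open {w\<in>ball 0 1. p w \<in> fst c}"
      using pc pf(3) by auto
    show "open {w\<in>U. \<phi> w \<in> fst c}" "(snd c \<circ> \<phi>) holomorphic_on {w\<in>U. \<phi> w \<in> fst c}"
      using analytic_from_plane_in_chart[OF X c \<phi> U] by auto
    show "deriv (snd c \<circ> p) (G w) \<noteq> 0" if "w \<in> {w\<in>U. \<phi> w \<in> fst c}" for w
      using that G' by (intro covering_deriv_nonzero[OF X p c]) auto
    show "continuous_on {w\<in>U. \<phi> w \<in> fst c} G"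
      by (rule continuous_on_subset[OF G'(1)]) auto
  qed (use G' in auto)
  show hG: "G holomorphic_on U"
  proof (rule holomorphic_on_subset[where s = "\<Union>c\<in>A. {w\<in>U. \<phi> w \<in> fst c}"])
    show "G holomorphic_on (\<Union>c\<in>A. {w\<in>U. \<phi> w \<in> fst c})"
      using hol analytic_from_plane_in_chart(1)[OF X _ \<phi> U]
      by (intro holomorphic_on_UN_open) auto
    show "U \<subseteq> (\<Union>c\<in>A. {w\<in>U. \<phi> w \<in> fst c})"
    proof
      fix w assume "w \<in> U"
      then have "\<phi> w \<in> (\<Union>c\<in>A. fst c)" using X \<phi>(2) unfolding riemann_surface_def by blast
      then show "w \<in> (\<Union>c\<in>A. {w\<in>U. \<phi> w \<in> fst c})" using \<open>w \<in> U\<close> by blast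
    qed
  qed
  fix c w assume c: "c \<in> A" "w \<in> U" "\<phi> w \<in> fst c"
  note pc = analytic_from_plane_in_chart[OF X c(1) pf(2) _ open_ball]
  have "((snd c \<circ> p) has_field_derivative deriv (snd c \<circ> p) (G w)) (at (G w))"
    using pc pf(3) c G' by (intro holomorphic_derivI[where S = "{w\<in>ball 0 1. p w \<in> fst c}"]) auto
  moreover have "(G has_field_derivative deriv G w) (at w)"
    using hG U c by (intro holomorphic_derivI)
  ultimately have "((\<lambda>w. (snd c \<circ> p) (G w)) has_field_derivative deriv (snd c \<circ> p) (G w) * deriv G w) (at w)"
    by (rule DERIV_chain2)
  then have "((snd c \<circ> \<phi>) has_field_derivative deriv (snd c \<circ> p) (G w) * deriv G w) (at w)"
    by (rule has_field_derivative_transform_within_open[OF _ U c(2)]) (simp add: G')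
  then show "deriv (snd c \<circ> \<phi>) w = deriv (snd c \<circ> p) (G w) * deriv G w"
    by (rule DERIV_imp_deriv)
qed

text \<open>Schwarz--Pick for maps from a plane disc into the surface: an analytic map lifts through \<open>p\<close> to a
  map between discs. The lift is only taken on the closed discs of radius \<open>r < \<rho>\<close>, and then
  \<open>r\<close> tends to \<open>\<rho>\<close>. This gives both the invariance of the hyperbolic density and the expansion
  of \<open>f\<close> over a punctured neighbourhood of \<open>\<infinity>\<close> free of singular values.\<close>

lemma surface_Schwarz_Pick:
  assumes X: "riemann_surface X A" and p: "disc_covering X A p"
    and \<phi>: "analytic_from_plane A \<phi> (ball w0 \<rho>)" "\<phi> ` ball w0 \<rho> \<subseteq> X" and \<rho>: "0 < \<rho>"
    and a: "a \<in> ball 0 1" "p a = \<phi> w0" and c: "c \<in> A" "\<phi> w0 \<in> fst c"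
  shows "cmod (deriv (snd c \<circ> \<phi>) w0) * \<rho> \<le> cmod (deriv (snd c \<circ> p) a) * (1 - (cmod a)\<^sup>2)"
proof -
  note pf = disc_covering_facts[OF p]
  have le: "cmod (deriv (snd c \<circ> \<phi>) w0) * r \<le> cmod (deriv (snd c \<circ> p) a) * (1 - (cmod a)\<^sup>2)"
    if r: "0 < r" "r < \<rho>" for r
  proof -
    have sub: "cball w0 r \<subseteq> ball w0 \<rho>" "ball w0 r \<subseteq> ball w0 \<rho>" using r by auto
    have "\<exists>G. is_lift p (ball 0 1) \<phi> (cball w0 r) G \<and> G w0 = a"
      using \<phi> sub r a
      by (intro covering_lift_exists[OF pf(1)])
        (auto simp: analytic_from_plane_def intro: continuous_on_subset)
    then obtain G where Gc: "is_lift p (ball 0 1) \<phi> (cball w0 r) G" and Ga: "G w0 = a" by blast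
    from Gc have G: "is_lift p (ball 0 1) \<phi> (ball w0 r) G"
      by (rule is_lift_subset) auto
    have \<phi>r: "analytic_from_plane A \<phi> (ball w0 r)" "\<phi> ` ball w0 r \<subseteq> X"
      using analytic_from_plane_subset[OF \<phi>(1) sub(2)] \<phi>(2) sub(2) by blast+
    have "deriv (snd c \<circ> \<phi>) w0 = deriv (snd c \<circ> p) (G w0) * deriv G w0"
      using lift_to_disc_holomorphic(2)[OF X p open_ball \<phi>r G c(1) _ c(2)] r by simp
    moreover have "cmod (deriv G w0) * r \<le> 1 - (cmod (G w0))\<^sup>2"
      using lift_to_disc_holomorphic(1)[OF X p open_ball \<phi>r G] G r
      by (intro Schwarz_Pick_ball) (auto simp: is_lift_def)
    ultimately show ?thesis
      by (simp add: norm_mult Ga mult_left_mono mult.assoc)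
  qed
  show ?thesis
  proof (cases "cmod (deriv (snd c \<circ> \<phi>) w0) = 0")
    case True
    then show ?thesis using le[of "\<rho>/2"] \<rho> by simp
  next
    case False
    then have pos: "0 < cmod (deriv (snd c \<circ> \<phi>) w0)" by simp
    have "\<rho> \<le> cmod (deriv (snd c \<circ> p) a) * (1 - (cmod a)\<^sup>2) / cmod (deriv (snd c \<circ> \<phi>) w0)"
      using le pos \<rho> by (intro dense_le_bounded[OF \<rho>]) (simp add: pos_le_divide_eq mult.commute)
    then show ?thesis using pos by (simp add: pos_le_divide_eq mult.commute)
  qed
qed

text \<open>Precomposing \<open>q\<close> with the disc automorphism that takes \<open>0\<close> to \<open>b\<close> gives a map to which
  the Schwarz--Pick inequality applies at the centre of the disc. By symmetry in \<open>p\<close> and \<open>q\<close>, equality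
  holds, which is the independence of the density of the choice of covering and of the point over \<open>z\<close>.\<close>

lemma covering_deriv_le:
  assumes X: "riemann_surface X A" and p: "disc_covering X A p" and q: "disc_covering X A q"
    and ab: "a \<in> ball 0 1" "b \<in> ball 0 1" "p a = q b" and c: "c \<in> A" "q b \<in> fst c"
  shows "cmod (deriv (snd c \<circ> q) b) * (1 - (cmod b)\<^sup>2) \<le> cmod (deriv (snd c \<circ> p) a) * (1 - (cmod a)\<^sup>2)"
proof -
  note qf = disc_covering_facts[OF q]
  define M where "M = Moebius_function 0 (-b)"
  have M: "M holomorphic_on ball 0 1" "M ` ball 0 1 \<subseteq> ball 0 1"
    using ab(2) Moebius_function_holomorphic[of "-b"] Moebius_function_norm_lt_1[of "-b"]
    by (auto simp: M_def)
  have M0: "M 0 = b" by (simp add: M_def Moebius_function_of_zero)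
  have bb: "cnj b * b = of_real ((cmod b)\<^sup>2)" using complex_norm_square[of b] by (simp add: mult.commute)
  have dM: "(M has_field_derivative of_real (1 - (cmod b)\<^sup>2)) (at 0)"
    using deriv_Moebius_function[of "-b" 0] bb by (simp add: M_def)
  have "cmod (deriv (snd c \<circ> (q \<circ> M)) 0) * 1 \<le> cmod (deriv (snd c \<circ> p) a) * (1 - (cmod a)\<^sup>2)"
  proof (rule surface_Schwarz_Pick[OF X p])
    show "analytic_from_plane A (q \<circ> M) (ball 0 1)"
      unfolding analytic_from_plane_def
    proof (intro conjI ballI)
      show "continuous_on (ball 0 1) (q \<circ> M)"
        using M qf(2) by (intro continuous_on_compose holomorphic_on_imp_continuous_on)
          (auto simp: analytic_from_plane_def intro: continuous_on_subset)
      fix d assume d: "d \<in> A"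
      note qd = analytic_from_plane_in_chart[OF X d qf(2) _ open_ball]
      have "((snd d \<circ> q) \<circ> M) holomorphic_on {w\<in>ball 0 1. (q \<circ> M) w \<in> fst d}"
      proof (rule holomorphic_on_compose_gen)
        show "M holomorphic_on {w\<in>ball 0 1. (q \<circ> M) w \<in> fst d}"
          using M(1) by (rule holomorphic_on_subset) auto
        show "(snd d \<circ> q) holomorphic_on {w\<in>ball 0 1. q w \<in> fst d}" using qd qf(3) by auto
        show "M ` {w\<in>ball 0 1. (q \<circ> M) w \<in> fst d} \<subseteq> {w\<in>ball 0 1. q w \<in> fst d}" using M(2) by fastforce
      qed
      then show "(snd d \<circ> (q \<circ> M)) holomorphic_on {w\<in>ball 0 1. (q \<circ> M) w \<in> fst d}"
        by (simp add: comp_assoc)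
    qed
    show "(q \<circ> M) ` ball 0 1 \<subseteq> X" using M(2) qf(3) by auto
  qed (use ab c M0 in auto)
  moreover have "deriv (snd c \<circ> (q \<circ> M)) 0 = deriv (snd c \<circ> q) b * of_real (1 - (cmod b)\<^sup>2)"
  proof (rule DERIV_imp_deriv)
    note qc = analytic_from_plane_in_chart[OF X c(1) qf(2) _ open_ball]
    have "((snd c \<circ> q) has_field_derivative deriv (snd c \<circ> q) b) (at (M 0))"
      unfolding M0 using qc qf(3) ab c
      by (intro holomorphic_derivI[where S = "{w\<in>ball 0 1. q w \<in> fst c}"]) auto
    from DERIV_chain[OF this dM]
    show "((snd c \<circ> (q \<circ> M)) has_field_derivative deriv (snd c \<circ> q) b * of_real (1 - (cmod b)\<^sup>2)) (at 0)"
      by (simp add: comp_assoc)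
  qed
  moreover have "(cmod b)\<^sup>2 < 1" using ab(2) by (simp add: abs_square_less_1)
  ultimately show ?thesis by (simp add: norm_mult del: of_real_diff)
qed

lemma hyperbolic_density_covering:
  assumes X: "riemann_surface X A" and p: "disc_covering X A p"
    and c: "c \<in> A" "\<zeta> \<in> ball 0 1" "p \<zeta> \<in> fst c"
  shows "hyperbolic_density X A c (p \<zeta>) * cmod (deriv (snd c \<circ> p) \<zeta>) = 2 / (1 - (cmod \<zeta>)\<^sup>2)"
proof -
  define r where "r = hyperbolic_density X A c (p \<zeta>)"
  have pos: "0 < 1 - (cmod \<zeta>)\<^sup>2" if "\<zeta> \<in> ball 0 1" for \<zeta> :: complex
    using that by (simp add: abs_square_less_1)
  have "\<exists>r q b. disc_covering X A q \<and> b \<in> ball 0 1 \<and> q b = p \<zeta> \<and>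
           r * cmod (deriv (snd c \<circ> q) b) = 2 / (1 - (cmod b)\<^sup>2)"
    using covering_deriv_nonzero[OF X p c] p c
    by (intro exI[of _ "2 / (1 - (cmod \<zeta>)\<^sup>2) / cmod (deriv (snd c \<circ> p) \<zeta>)"] exI[of _ p] exI[of _ \<zeta>]) auto
  then have "\<exists>q b. disc_covering X A q \<and> b \<in> ball 0 1 \<and> q b = p \<zeta> \<and>
           r * cmod (deriv (snd c \<circ> q) b) = 2 / (1 - (cmod b)\<^sup>2)"
    unfolding r_def hyperbolic_density_def by (rule someI_ex)
  \<comment> \<open>The density was chosen with some covering \<open>q\<close> and point \<open>b\<close>, not with the given \<open>p\<close> and \<open>\<zeta>\<close>.\<close>
  then obtain q b where q: "disc_covering X A q" "b \<in> ball 0 1" "q b = p \<zeta>"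
      "r * cmod (deriv (snd c \<circ> q) b) = 2 / (1 - (cmod b)\<^sup>2)"
    by blast
  have "cmod (deriv (snd c \<circ> q) b) * (1 - (cmod b)\<^sup>2) = cmod (deriv (snd c \<circ> p) \<zeta>) * (1 - (cmod \<zeta>)\<^sup>2)"
    using covering_deriv_le[OF X p q(1) c(2) q(2) _ c(1)] covering_deriv_le[OF X q(1) p q(2) c(2) _ c(1)]
      q(3) c(3) by (intro antisym) auto
  moreover have "r * (cmod (deriv (snd c \<circ> q) b) * (1 - (cmod b)\<^sup>2)) = 2"
    using q(4) pos[OF q(2)] by (simp add: field_simps)
  ultimately have "r * (cmod (deriv (snd c \<circ> p) \<zeta>) * (1 - (cmod \<zeta>)\<^sup>2)) = 2" by simp
  then show ?thesis unfolding r_def[symmetric] using pos[OF c(2)]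
    by (simp add: eq_divide_eq mult.assoc)
qed

lemma chart_deriv_chain:
  assumes X: "riemann_surface X A" and f: "analytic_to_plane A f X"
    and U: "open U" and \<phi>: "analytic_from_plane A \<phi> U" "\<phi> ` U \<subseteq> X"
    and c: "c \<in> A" "w \<in> U" "\<phi> w \<in> fst c"
  shows "((f \<circ> \<phi>) has_field_derivative
           deriv (f \<circ> chart_inv c) (snd c (\<phi> w)) * deriv (snd c \<circ> \<phi>) w) (at w)"
proof -
  note cf = chart_facts[OF X c(1)]
  note \<phi>c = analytic_from_plane_in_chart[OF X c(1) \<phi> U]
  have "((f \<circ> chart_inv c) has_field_derivative deriv (f \<circ> chart_inv c) (snd c (\<phi> w))) (at ((snd c \<circ> \<phi>) w))"
    using analytic_in_chart[OF X f c(1)] cf(3) c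
    by (simp add: holomorphic_derivI[where S = "snd c ` fst c"])
  moreover have "((snd c \<circ> \<phi>) has_field_derivative deriv (snd c \<circ> \<phi>) w) (at w)"
    using \<phi>c c by (intro holomorphic_derivI[where S = "{w\<in>U. \<phi> w \<in> fst c}"]) auto
  ultimately have "((f \<circ> chart_inv c) \<circ> (snd c \<circ> \<phi>) has_field_derivative
      deriv (f \<circ> chart_inv c) (snd c (\<phi> w)) * deriv (snd c \<circ> \<phi>) w) (at w)"
    by (rule DERIV_chain)
  then show ?thesis
    by (rule has_field_derivative_transform_within_open[OF _ \<phi>c(1)]) (use c cf(6) in auto)
qed

text \<open>Through a universal covering, the norm of the derivative becomes an expression in the plane
  function \<open>f \<circ> p\<close> on the disc; charts and the density drop out by the chain rule.\<close>

lemma deriv_norm_covering: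
  assumes X: "riemann_surface X A" and f: "analytic_to_plane A f X" and p: "disc_covering X A p"
    and \<zeta>: "\<zeta> \<in> ball 0 1"
  shows "deriv_norm X A f (p \<zeta>) = cmod (deriv (f \<circ> p) \<zeta>) * (1 - (cmod \<zeta>)\<^sup>2) / (2 * cmod (f (p \<zeta>)))"
proof -
  note pf = disc_covering_facts[OF p]
  have "p \<zeta> \<in> X" using pf(3) \<zeta> by blast
  define c where "c = chart_at A (p \<zeta>)"
  have c: "c \<in> A" "p \<zeta> \<in> fst c" using chart_at_facts[OF X \<open>p \<zeta> \<in> X\<close>] by (auto simp: c_def)
  have pos: "0 < 1 - (cmod \<zeta>)\<^sup>2" using \<zeta> by (simp add: abs_square_less_1)
  have nz: "deriv (snd c \<circ> p) \<zeta> \<noteq> 0" by (rule covering_deriv_nonzero[OF X p c(1) \<zeta> c(2)])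
  have "hyperbolic_density X A c (p \<zeta>) = 2 / (1 - (cmod \<zeta>)\<^sup>2) / cmod (deriv (snd c \<circ> p) \<zeta>)"
    using hyperbolic_density_covering[OF X p c(1) \<zeta> c(2)] nz by (metis nonzero_mult_div_cancel_right norm_eq_zero)
  moreover have "deriv (f \<circ> p) \<zeta> = deriv (f \<circ> chart_inv c) (snd c (p \<zeta>)) * deriv (snd c \<circ> p) \<zeta>"
    using chart_deriv_chain[OF X f open_ball pf(2) _ c(1) \<zeta> c(2)] pf(3) by (auto intro: DERIV_imp_deriv)
  ultimately show ?thesis
    using pos nz by (simp add: deriv_norm_def Let_def c_def[symmetric] norm_mult mult_ac)
qed

section \<open>Bounded singular set implies infinite expansion\<close>

lemma eta_eq_SUP:
  "eta X A f = (SUP R. INF z\<in>{z\<in>X. cmod (f z) > R}. ereal (deriv_norm X A f z))"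
proof -
  define g where "g = (\<lambda>R::real. INF z\<in>{z\<in>X. cmod (f z) > R}. ereal (deriv_norm X A f z))"
  have mono: "g R \<le> g R'" if "R \<le> R'" for R R'
    unfolding g_def using that by (intro INF_superset_mono) auto
  have "(g \<longlongrightarrow> (SUP R. g R)) at_top"
  proof (rule order_tendstoI)
    fix a assume "a < (SUP R. g R)"
    then obtain R where "a < g R" by (auto simp: less_SUP_iff)
    then show "\<forall>\<^sub>F x in at_top. a < g x"
      using mono by (auto simp: eventually_at_top_linorder intro!: exI[of _ R] intro: less_le_trans)
  next
    fix a assume a: "(SUP R. g R) < a"
    have "g x \<le> (SUP R. g R)" for x by (rule SUP_upper) simp
    then show "\<forall>\<^sub>F x in at_top. g x < a"
      using a le_less_trans by (intro always_eventually allI) blast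
  qed
  then show ?thesis
    unfolding eta_def g_def by (intro tendsto_Lim) auto
qed

text \<open>The lift \<open>\<phi>\<close> of \<open>exp\<close> is an inverse branch of \<open>f\<close> in the logarithmic coordinate, in which the
  cylindrical metric is Euclidean. Thus the norm of \<open>Df\<close> is the reciprocal of the hyperbolic size of
  \<open>\<phi>'\<close>, which Schwarz--Pick bounds by \<open>2/\<rho>\<close>.\<close>

lemma deriv_norm_ge_if_exp_lift:
  assumes X: "riemann_surface X A" and f: "analytic_to_plane A f X" and p: "disc_covering X A p"
    and \<rho>: "0 < \<rho>" and \<phi>: "analytic_from_plane A \<phi> (ball w0 \<rho>)" "\<phi> ` ball w0 \<rho> \<subseteq> X"
    and exp: "\<And>w. w \<in> ball w0 \<rho> \<Longrightarrow> f (\<phi> w) = exp w"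
  shows "\<rho> / 2 \<le> deriv_norm X A f (\<phi> w0)"
proof -
  note pf = disc_covering_facts[OF p]
  have w0: "w0 \<in> ball w0 \<rho>" using \<rho> by simp
  then have "\<phi> w0 \<in> X" using \<phi> by blast
  with pf(3) obtain a where a: "a \<in> ball 0 1" "p a = \<phi> w0" by force
  define c where "c = chart_at A (\<phi> w0)"
  have c: "c \<in> A" "\<phi> w0 \<in> fst c" using chart_at_facts[OF X \<open>\<phi> w0 \<in> X\<close>] by (auto simp: c_def)
  define D where "D = cmod (deriv (f \<circ> chart_inv c) (snd c (\<phi> w0)))"
  define e where "e = cmod (deriv (snd c \<circ> \<phi>) w0)"
  define dens where "dens = hyperbolic_density X A c (\<phi> w0)"
  have "((f \<circ> \<phi>) has_field_derivative
      deriv (f \<circ> chart_inv c) (snd c (\<phi> w0)) * deriv (snd c \<circ> \<phi>) w0) (at w0)"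
    by (rule chart_deriv_chain[OF X f open_ball \<phi> c(1) w0 c(2)])
  moreover have "((f \<circ> \<phi>) has_field_derivative exp w0) (at w0)"
    by (rule has_field_derivative_transform_within_open[OF DERIV_exp open_ball w0]) (simp add: exp)
  ultimately have "deriv (f \<circ> chart_inv c) (snd c (\<phi> w0)) * deriv (snd c \<circ> \<phi>) w0 = exp w0"
    by (rule DERIV_unique)
  then have De: "D * e = cmod (f (\<phi> w0))" "D * e > 0"
    using exp[OF w0] unfolding D_def e_def by (simp_all flip: norm_mult)
  then have e: "e > 0" "D > 0" by (auto simp: zero_less_mult_iff e_def D_def)
  have a1: "1 - (cmod a)\<^sup>2 > 0" using a by (simp add: abs_square_less_1)
  have h: "dens * cmod (deriv (snd c \<circ> p) a) = 2 / (1 - (cmod a)\<^sup>2)"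
    using hyperbolic_density_covering[OF X p c(1) a(1)] a c by (simp add: dens_def)
  then have "dens * (cmod (deriv (snd c \<circ> p) a) * (1 - (cmod a)\<^sup>2)) = 2"
    using a1 by (metis divide_eq_eq less_irrefl mult.assoc)
  moreover have dens: "dens > 0"
    using h a1 by (metis divide_pos_pos norm_ge_zero not_less zero_less_mult_iff zero_less_numeral)
  ultimately have "dens * (e * \<rho>) \<le> 2"
    using surface_Schwarz_Pick[OF X p \<phi> \<rho> a c] mult_left_mono unfolding e_def
    by (metis less_imp_le)
  then have "\<rho> / 2 \<le> 1 / (e * dens)" using e dens by (simp add: field_simps)
  also have "\<dots> = D / (cmod (f (\<phi> w0)) * dens)" using e by (simp flip: De(1))
  also have "\<dots> = deriv_norm X A f (\<phi> w0)"
    by (simp add: deriv_norm_def Let_def c_def D_def dens_def)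
  finally show ?thesis .
qed

lemma regular_value_locally_injective:
  assumes X: "riemann_surface X A" and f: "analytic_to_plane A f X"
    and z: "z \<in> X" "regular_value X A f (f z)"
  obtains W where "openin (top_of_set X) W" "z \<in> W" "inj_on f W"
proof -
  obtain U where U: "open U" "f z \<in> U"
      "\<And>V. V \<in> components {z\<in>X. f z \<in> U} \<Longrightarrow> conformal_isomorphism A f V U"
    using z(2) unfolding regular_value_def by blast
  define S where "S = {z\<in>X. f z \<in> U}"
  have "openin (top_of_set X) (X \<inter> f -` U)"
    using analytic_to_plane_continuous[OF X f] U(1) by (rule continuous_openin_preimage_gen)
  moreover have "X \<inter> f -` U = S" by (auto simp: S_def)
  ultimately have S: "openin (top_of_set X) S" "z \<in> S" using z U by (auto simp: S_def)
  obtain W where W: "openin (top_of_set X) W" "z \<in> W" "connected W" "W \<subseteq> S"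
    by (rule connected_neighbourhood_in_surface[OF X S])
  have "W \<subseteq> connected_component_set S z" using W by (intro connected_component_maximal)
  moreover have "connected_component_set S z \<in> components S" using S by (intro componentsI)
  then have "inj_on f (connected_component_set S z)"
    using U(3) unfolding S_def conformal_isomorphism_def bij_betw_def by blast
  ultimately have "inj_on f W" by (meson inj_on_subset)
  with W show ?thesis using that by blast
qed

lemma lift_to_surface_analytic:
  assumes X: "riemann_surface X A" and f: "analytic_to_plane A f X"
    and T: "T \<subseteq> X" "\<And>z c. z \<in> T \<Longrightarrow> c \<in> A \<Longrightarrow> z \<in> fst c \<Longrightarrow> deriv (f \<circ> chart_inv c) (snd c z) \<noteq> 0"
    and U: "open U" and E: "E holomorphic_on U" and \<phi>: "is_lift f T E U \<phi>"
  shows "analytic_from_plane A \<phi> U"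
  unfolding analytic_from_plane_def
proof (intro conjI ballI)
  show cont: "continuous_on U \<phi>" using \<phi> by (simp add: is_lift_def)
  fix c assume c: "c \<in> A"
  note cf = chart_facts[OF X c]
  define S where "S = {w\<in>U. \<phi> w \<in> fst c}"
  have \<phi>T: "\<phi> w \<in> T" "f (\<phi> w) = E w" if "w \<in> U" for w using \<phi> that by (auto simp: is_lift_def)
  have "openin (top_of_set U) (U \<inter> \<phi> -` fst c)"
    using cf(1) cont \<phi>T(1) T(1) by (intro continuous_openin_preimage[where T = X]) auto
  moreover have "U \<inter> \<phi> -` fst c = S" by (auto simp: S_def)
  ultimately have "open S" using U openin_open_eq by metis
  show "(snd c \<circ> \<phi>) holomorphic_on {w\<in>U. \<phi> w \<in> fst c}"
    unfolding S_def[symmetric]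
  proof (rule lift_holomorphic[OF analytic_in_chart[OF X f c] cf(3) _ _ \<open>open S\<close>])
    show "continuous_on S (snd c \<circ> \<phi>)"
      using cont cf(4) by (intro continuous_on_compose) (auto simp: S_def intro: continuous_on_subset)
    show "E holomorphic_on S" using E by (rule holomorphic_on_subset) (auto simp: S_def)
  qed (use T \<phi>T c cf(6) in \<open>auto simp: S_def\<close>)
qed

text \<open>On the disc of radius \<open>\<rho>\<close> about \<open>Ln (f z)\<close>, the values of \<open>exp\<close> have modulus greater than \<open>R\<close>, hence are
  regular. Over a small neighbourhood of such a value, \<open>f\<close> has an inverse branch with any prescribed
  preimage as its value, and so \<open>exp\<close> lifts through \<open>f\<close> along the compact disc.\<close>

lemma exp_lift_exists:
  assumes X: "riemann_surface X A" and f: "analytic_to_plane A f X"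
    and R: "0 < R" "\<And>s. R < cmod s \<Longrightarrow> regular_value X A f s"
    and z: "z \<in> X" and \<rho>: "0 < \<rho>" "\<rho> < ln (cmod (f z)) - ln R" "f z \<noteq> 0"
  shows "\<exists>\<phi>. analytic_from_plane A \<phi> (ball (Ln (f z)) \<rho>) \<and> \<phi> ` ball (Ln (f z)) \<rho> \<subseteq> X \<and>
             \<phi> (Ln (f z)) = z \<and> (\<forall>w\<in>ball (Ln (f z)) \<rho>. f (\<phi> w) = exp w)"
proof -
  define w0 where "w0 = Ln (f z)"
  define T where "T = {x\<in>X. R < cmod (f x)}"
  have exp_outer: "R < cmod (exp w)" if "w \<in> cball w0 \<rho>" for w
  proof -
    have "Re w0 - Re w \<le> \<rho>"
      using that complex_Re_le_cmod[of "w0 - w"] by (simp add: dist_norm)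
    then have "ln R < Re w" using \<rho> by (simp add: w0_def)
    then have "exp (ln R) < exp (Re w)" by simp
    then show ?thesis using R(1) by simp
  qed
  have nz: "deriv (f \<circ> chart_inv c) (snd c x) \<noteq> 0" if "x \<in> T" "c \<in> A" "x \<in> fst c" for x c
  proof -
    have x: "x \<in> X" "regular_value X A f (f x)" using that R by (auto simp: T_def)
    obtain W where "openin (top_of_set X) W" "x \<in> W" "inj_on f W"
      by (rule regular_value_locally_injective[OF X f x])
    then show ?thesis by (rule chart_deriv_nonzero_if_injective[OF X f that(2,3)])
  qed
  have "locally_injective_on f T"
  proof (rule locally_injective_if_chart_deriv_nonzero[OF X f])
    show "\<exists>c\<in>A. x \<in> fst c \<and> deriv (f \<circ> chart_inv c) (snd c x) \<noteq> 0" if "x \<in> T" for x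
      using nz[OF that chart_at_facts[OF X]] chart_at_facts[OF X] that by (auto simp: T_def)
  qed (auto simp: T_def)
  have "\<exists>\<phi>. is_lift f T exp (cball w0 \<rho>) \<phi> \<and> \<phi> w0 = z"
  proof (rule lift_exists_compact[where F = f and E = exp, OF convex_cball compact_cball])
    show "f z = exp w0" using \<rho> by (simp add: w0_def)
    then show "z \<in> T" using exp_outer[of w0] z \<rho> by (simp add: T_def)
    fix w assume w: "w \<in> cball w0 \<rho>"
    obtain U where U: "open U" "exp w \<in> U"
        "\<And>V. V \<in> components {z\<in>X. f z \<in> U} \<Longrightarrow> conformal_isomorphism A f V U"
      using R(2)[OF exp_outer[OF w]] unfolding regular_value_def by blast
    define S where "S = {z\<in>X. f z \<in> U}"
    have "open ((exp :: complex \<Rightarrow> complex) -` U)"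
      using U(1) continuous_on_exp[OF continuous_on_id] by (intro open_vimage) auto
    moreover have "\<exists>H. is_lift f T exp (cball w0 \<rho> \<inter> exp -` U) H \<and> H v = x"
      if v: "v \<in> cball w0 \<rho> \<inter> exp -` U" and x: "x \<in> T" "f x = exp v" for v x
    proof -
      have "x \<in> S" using v x by (auto simp: S_def T_def)
      define V where "V = connected_component_set S x"
      have "V \<in> components S" using \<open>x \<in> S\<close> by (auto simp: V_def intro: componentsI)
      have "x \<in> V" "V \<subseteq> S" using \<open>x \<in> S\<close> connected_component_subset by (auto simp: V_def)
      have "conformal_isomorphism A f V U" using U(3) \<open>V \<in> components S\<close> by (simp add: S_def)
      then have V: "inj_on f V" "f ` V = U" "continuous_on U (inv_into V f)"
        by (auto simp: conformal_isomorphism_def bij_betw_def analytic_from_plane_def)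
      have "is_lift f T exp (cball w0 \<rho> \<inter> exp -` U) (inv_into V f \<circ> exp)"
        unfolding is_lift_def
      proof (intro conjI ballI subsetI)
        show "continuous_on (cball w0 \<rho> \<inter> exp -` U) (inv_into V f \<circ> exp)"
          by (intro continuous_on_compose continuous_on_exp continuous_on_id
              continuous_on_subset[OF V(3)]) auto
        show fH: "f ((inv_into V f \<circ> exp) u) = exp u" if "u \<in> cball w0 \<rho> \<inter> exp -` U" for u
          using that V(2) by (auto intro: f_inv_into_f)
        fix y assume "y \<in> (inv_into V f \<circ> exp) ` (cball w0 \<rho> \<inter> exp -` U)"
        then obtain u where u: "u \<in> cball w0 \<rho> \<inter> exp -` U" "y = (inv_into V f \<circ> exp) u" by blast
        then have "y \<in> V" using V(2) by (auto intro: inv_into_into)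
        moreover have "R < cmod (f y)" using fH[OF u(1)] u exp_outer[of u] by simp
        ultimately show "y \<in> T" using \<open>V \<subseteq> S\<close> by (auto simp: T_def S_def)
      qed
      moreover have "(inv_into V f \<circ> exp) v = x"
        using V(1) \<open>x \<in> V\<close> x(2) by (metis comp_apply inv_into_f_f)
      ultimately show ?thesis by blast
    qed
    ultimately show "\<exists>N. open N \<and> w \<in> N \<and>
        (\<forall>v\<in>cball w0 \<rho> \<inter> N. \<forall>x\<in>T. f x = exp v \<longrightarrow> (\<exists>H. is_lift f T exp (cball w0 \<rho> \<inter> N) H \<and> H v = x))"
      using U(2) by (intro exI[of _ "exp -` U"]) auto
  qed (use \<rho> \<open>locally_injective_on f T\<close> in auto)
  then obtain \<phi> where \<phi>c: "is_lift f T exp (cball w0 \<rho>) \<phi>" and \<phi>z: "\<phi> w0 = z" by blast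
  from \<phi>c have \<phi>: "is_lift f T exp (ball w0 \<rho>) \<phi>" by (rule is_lift_subset) auto
  have "analytic_from_plane A \<phi> (ball w0 \<rho>)"
    by (rule lift_to_surface_analytic[OF X f _ nz open_ball _ \<phi>])
      (auto simp: T_def intro: holomorphic_intros)
  then show ?thesis
    using \<phi> \<phi>z unfolding w0_def[symmetric] by (intro exI[of _ \<phi>]) (auto simp: is_lift_def T_def)
qed

text \<open>As \<open>|f z|\<close> grows, \<open>exp\<close> lifts on discs about \<open>Ln (f z)\<close> of radius almost \<open>ln |f z| - ln R\<close>,
  which is unbounded.\<close>

lemma eta_infinite_if_class_B:
  assumes X: "hyperbolic_surface X A" and f: "f \<in> class_B X A"
  shows "eta X A f = \<infinity>"
proof (rule ereal_top)
  fix M :: real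
  obtain p where X: "riemann_surface X A" and p: "disc_covering X A p"
    using X unfolding hyperbolic_surface_def by blast
  have f: "analytic_to_plane A f X" "bounded (singular_values X A f)"
    using f by (auto simp: class_B_def)
  obtain R where R: "0 < R" "\<And>s. s \<in> singular_values X A f \<Longrightarrow> cmod s \<le> R"
    using f(2) by (auto simp: bounded_pos)
  \<comment> \<open>Any positive radius that is at least \<open>2 * M\<close> would do.\<close>
  define \<rho> where "\<rho> = 2 * \<bar>M\<bar> + 1"
  have ge: "M \<le> deriv_norm X A f z" if z: "z \<in> X" "R * exp \<rho> < cmod (f z)" for z
  proof -
    have "0 < R * exp \<rho>" using R by simp
    then have fz: "f z \<noteq> 0" "cmod (f z) > 0" using z by auto
    have "ln (R * exp \<rho>) < ln (cmod (f z))" using z fz \<open>0 < R * exp \<rho>\<close> by (subst ln_less_cancel_iff)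
    then have "\<rho> < ln (cmod (f z)) - ln R" using R by (simp add: ln_mult)
    moreover have "0 < \<rho>" by (simp add: \<rho>_def)
    moreover have "regular_value X A f s" if "R < cmod s" for s
      using R(2)[of s] that by (auto simp: singular_values_def)
    ultimately obtain \<phi> where \<phi>: "analytic_from_plane A \<phi> (ball (Ln (f z)) \<rho>)"
        "\<phi> ` ball (Ln (f z)) \<rho> \<subseteq> X" "\<phi> (Ln (f z)) = z" "\<And>w. w \<in> ball (Ln (f z)) \<rho> \<Longrightarrow> f (\<phi> w) = exp w"
      using exp_lift_exists[OF X f(1) R(1) _ z(1)] fz by blast
    have "\<rho> / 2 \<le> deriv_norm X A f (\<phi> (Ln (f z)))"
      by (rule deriv_norm_ge_if_exp_lift[OF X f(1) p \<open>0 < \<rho>\<close> \<phi>(1,2,4)])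
    then show ?thesis by (simp add: \<phi>(3) \<rho>_def)
  qed
  have "ereal M \<le> (INF z\<in>{z\<in>X. cmod (f z) > R * exp \<rho>}. ereal (deriv_norm X A f z))"
    using ge by (intro INF_greatest) auto
  also have "\<dots> \<le> eta X A f" unfolding eta_eq_SUP by (rule SUP_upper) simp
  finally show "ereal M \<le> eta X A f" .
qed

section \<open>Expansion implies bounded singular set\<close>

text \<open>Inverse branches exist on discs of a common radius as long as the initial point stays in a compact
  set without critical points. A point near \<open>\<zeta>\<close> is served by the branch at \<open>\<zeta>\<close>, at half its
  radius, so that a finite subcover determines \<open>\<delta>\<close>.\<close>

lemma uniform_inverse_branches:
  assumes F: "F holomorphic_on U" "open U" and K: "compact K" "K \<subseteq> U"
    and d: "\<And>\<zeta>. \<zeta> \<in> K \<Longrightarrow> deriv F \<zeta> \<noteq> 0"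
  obtains \<delta> where "0 < \<delta>"
    "\<And>\<zeta>. \<zeta> \<in> K \<Longrightarrow> \<exists>H. is_lift F U (\<lambda>w. w) (ball (F \<zeta>) \<delta>) H \<and> H (F \<zeta>) = \<zeta>"
proof -
  have "\<exists>N \<epsilon>. open N \<and> \<zeta> \<in> N \<and> 0 < \<epsilon> \<and>
          (\<forall>\<xi>\<in>N. \<exists>H. is_lift F U (\<lambda>w. w) (ball (F \<xi>) \<epsilon>) H \<and> H (F \<xi>) = \<xi>)" if \<zeta>: "\<zeta> \<in> K" for \<zeta>
  proof -
    have "\<zeta> \<in> U" using \<zeta> K by blast
    obtain M \<Psi> where M: "open M" "\<zeta> \<in> M" "M \<subseteq> U" "open (F ` M)" "\<Psi> holomorphic_on F ` M"
        "\<And>z. z \<in> M \<Longrightarrow> \<Psi> (F z) = z"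
      using local_inverse_branch[OF F \<open>\<zeta> \<in> U\<close> d[OF \<zeta>]] by metis
    have "F \<zeta> \<in> F ` M" using M by blast
    then obtain e where e: "0 < e" "ball (F \<zeta>) e \<subseteq> F ` M" using M(4) openE by blast
    define N where "N = M \<inter> F -` ball (F \<zeta>) (e/2)"
    have "continuous_on M F"
      using F(1) M(3) holomorphic_on_imp_continuous_on continuous_on_subset by blast
    then have "open N" unfolding N_def using M(1) by (intro continuous_open_preimage) auto
    moreover have "\<zeta> \<in> N" using M e by (simp add: N_def)
    moreover have "\<exists>H. is_lift F U (\<lambda>w. w) (ball (F \<xi>) (e/2)) H \<and> H (F \<xi>) = \<xi>" if \<xi>: "\<xi> \<in> N" for \<xi>
    proof -
      have "ball (F \<xi>) (e/2) \<subseteq> ball (F \<zeta>) e"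
      proof
        fix w assume "w \<in> ball (F \<xi>) (e/2)"
        then show "w \<in> ball (F \<zeta>) e"
          using \<xi> dist_triangle[of "F \<zeta>" w "F \<xi>"] by (auto simp: N_def)
      qed
      then have sub: "ball (F \<xi>) (e/2) \<subseteq> F ` M" using e by blast
      then have "is_lift F U (\<lambda>w. w) (ball (F \<xi>) (e/2)) \<Psi>"
        unfolding is_lift_def
      proof (intro conjI ballI subsetI)
        show "continuous_on (ball (F \<xi>) (e/2)) \<Psi>"
          using M(5) sub holomorphic_on_imp_continuous_on continuous_on_subset by blast
        show "F (\<Psi> w) = w" if "w \<in> ball (F \<xi>) (e/2)" for w
          using that sub M(6) by force
        show "y \<in> U" if "y \<in> \<Psi> ` ball (F \<xi>) (e/2)" for y
          using that sub M(3,6) by force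
      qed
      moreover have "\<Psi> (F \<xi>) = \<xi>" using \<xi> M(6) by (simp add: N_def)
      ultimately show ?thesis by blast
    qed
    ultimately show ?thesis using e(1) by (intro exI[of _ N] exI[of _ "e/2"]) auto
  qed
  then obtain N \<epsilon> where N\<epsilon>: "\<And>\<zeta>. \<zeta> \<in> K \<Longrightarrow> open (N \<zeta>)" "\<And>\<zeta>. \<zeta> \<in> K \<Longrightarrow> \<zeta> \<in> N \<zeta>" "\<And>\<zeta>. \<zeta> \<in> K \<Longrightarrow> 0 < \<epsilon> \<zeta>"
      "\<And>\<zeta> \<xi>. \<zeta> \<in> K \<Longrightarrow> \<xi> \<in> N \<zeta> \<Longrightarrow> \<exists>H. is_lift F U (\<lambda>w. w) (ball (F \<xi>) (\<epsilon> \<zeta>)) H \<and> H (F \<xi>) = \<xi>"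
    by metis
  have "K \<subseteq> (\<Union>\<zeta>\<in>K. N \<zeta>)" using N\<epsilon>(2) by blast
  then obtain C where C: "C \<subseteq> K" "finite C" "K \<subseteq> (\<Union>\<zeta>\<in>C. N \<zeta>)"
    using compactE_image[OF K(1), of K N] N\<epsilon>(1) by blast
  define \<delta> where "\<delta> = Min (insert (1::real) (\<epsilon> ` C))"
  have "0 < \<delta>" using C N\<epsilon>(3) by (auto simp: \<delta>_def)
  moreover have "\<exists>H. is_lift F U (\<lambda>w. w) (ball (F \<zeta>) \<delta>) H \<and> H (F \<zeta>) = \<zeta>" if \<zeta>: "\<zeta> \<in> K" for \<zeta>
  proof -
    obtain \<eta> where \<eta>: "\<eta> \<in> C" "\<zeta> \<in> N \<eta>" using \<zeta> C(3) by blast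
    then have "\<delta> \<le> \<epsilon> \<eta>" using C(2) by (simp add: \<delta>_def)
    moreover obtain H where "is_lift F U (\<lambda>w. w) (ball (F \<zeta>) (\<epsilon> \<eta>)) H" "H (F \<zeta>) = \<zeta>"
      using N\<epsilon>(4)[of \<eta> \<zeta>] \<eta> C(1) by blast
    ultimately show ?thesis by (meson is_lift_subset subset_ball)
  qed
  ultimately show ?thesis by (rule that)
qed

text \<open>A lower bound \<open>c\<close> for the expansion from the hyperbolic to the Euclidean metric keeps lifts of
  a segment of length at most \<open>L\<close> within a bounded hyperbolic distance of their starting point. In
  terms of \<open>y = 1 - |\<phi>|\<^sup>2\<close>, the bound reads \<open>|\<phi>'| \<le> (L/c) y\<close>, so \<open>y' \<ge> - (2 L/c) y\<close>, and
  \<open>y\<close> cannot decay faster than exponentially.\<close>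

lemma segment_lift_stays_inside:
  fixes \<phi> :: "real \<Rightarrow> complex"
  assumes F: "F holomorphic_on ball 0 1"
    and c: "0 < c" "\<And>\<zeta>. \<zeta> \<in> T \<Longrightarrow> c \<le> cmod (deriv F \<zeta>) * (1 - (cmod \<zeta>)\<^sup>2)" and T: "T \<subseteq> ball 0 1"
    and \<phi>: "is_lift F T (\<lambda>\<tau>. w0 + of_real \<tau> * v) {0..1} \<phi>" and v: "cmod v \<le> L"
  shows "(1 - (cmod (\<phi> 0))\<^sup>2) * exp (- (2 * L / c)) \<le> 1 - (cmod (\<phi> 1))\<^sup>2"
proof -
  define k where "k = 2 * L / c"
  define u where "u = (\<lambda>\<tau>. (1 - \<phi> \<tau> \<bullet> \<phi> \<tau>) * exp (k * \<tau>))"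
  have \<phi>': "continuous_on {0..1} \<phi>" "\<And>\<tau>. \<tau> \<in> {0..1} \<Longrightarrow> \<phi> \<tau> \<in> T"
      "\<And>\<tau>. \<tau> \<in> {0..1} \<Longrightarrow> F (\<phi> \<tau>) = w0 + of_real \<tau> * v"
    using \<phi> by (auto simp: is_lift_def)
  have cont: "continuous_on {0..1} u" unfolding u_def using \<phi>'(1) by (intro continuous_intros)
  have du: "\<exists>y. (u has_real_derivative y) (at \<tau>) \<and> 0 \<le> y" if \<tau>: "0 < \<tau>" "\<tau> < 1" for \<tau>
  proof -
    from \<tau> have \<tau>': "\<tau> \<in> {0..1}" "\<tau> \<in> {0<..<1}" by auto
    have \<phi>T: "\<phi> \<tau> \<in> T" using \<phi>'(2) \<tau>' by blast
    then have pos: "1 - (cmod (\<phi> \<tau>))\<^sup>2 > 0" using T by (auto simp: abs_square_less_1)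
    have nz: "deriv F (\<phi> \<tau>) \<noteq> 0" using c(1) c(2)[OF \<phi>T] by auto
    define d where "d = v / deriv F (\<phi> \<tau>)"
    have "(\<phi> has_derivative (\<lambda>h. (of_real h * v) / deriv F (\<phi> \<tau>))) (at \<tau> within {0<..<1})"
    proof (rule lift_has_derivative[where \<phi> = \<phi> and x = \<tau>, OF F open_ball _ nz])
      show "((\<lambda>\<tau>. w0 + of_real \<tau> * v) has_derivative (\<lambda>h. of_real h * v)) (at \<tau> within {0<..<1})"
        by (auto intro!: derivative_eq_intros)
      show "continuous_on {0<..<1} \<phi>" by (rule continuous_on_subset[OF \<phi>'(1)]) auto
    qed (use \<phi>T T \<tau>' \<phi>'(3) in auto)
    then have "(\<phi> has_derivative (\<lambda>h. (of_real h * v) / deriv F (\<phi> \<tau>))) (at \<tau>)"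
      using \<tau>' by (subst (asm) at_within_open) auto
    then have "(\<phi> has_derivative (\<lambda>h. h *\<^sub>R d)) (at \<tau>)"
      by (simp add: d_def scaleR_conv_of_real)
    then have "((\<lambda>\<tau>. \<phi> \<tau> \<bullet> \<phi> \<tau>) has_derivative (\<lambda>h. \<phi> \<tau> \<bullet> (h *\<^sub>R d) + (h *\<^sub>R d) \<bullet> \<phi> \<tau>)) (at \<tau>)"
      by (intro has_derivative_inner)
    then have dn: "((\<lambda>\<tau>. \<phi> \<tau> \<bullet> \<phi> \<tau>) has_real_derivative 2 * (\<phi> \<tau> \<bullet> d)) (at \<tau>)"
      unfolding has_field_derivative_def
      by (rule has_derivative_eq_rhs) (auto simp: inner_commute)
    have "(u has_real_derivative
        (- (2 * (\<phi> \<tau> \<bullet> d))) * exp (k * \<tau>) + (1 - \<phi> \<tau> \<bullet> \<phi> \<tau>) * (exp (k * \<tau>) * k)) (at \<tau>)"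
      unfolding u_def by (rule derivative_eq_intros dn refl | simp)+
    moreover have "0 \<le> (- (2 * (\<phi> \<tau> \<bullet> d))) * exp (k * \<tau>) + (1 - \<phi> \<tau> \<bullet> \<phi> \<tau>) * (exp (k * \<tau>) * k)"
    proof -
      have "\<phi> \<tau> \<bullet> d \<le> cmod (\<phi> \<tau>) * cmod d" by (rule norm_cauchy_schwarz)
      also have "\<dots> \<le> 1 * cmod d"
        using \<phi>T T by (intro mult_right_mono) (auto intro: less_imp_le)
      also have "c * cmod d \<le> L * (1 - (cmod (\<phi> \<tau>))\<^sup>2)"
      proof -
        have "c * cmod d \<le> cmod (deriv F (\<phi> \<tau>)) * (1 - (cmod (\<phi> \<tau>))\<^sup>2) * cmod d"
          using c(2)[OF \<phi>T] by (intro mult_right_mono) auto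
        also have "\<dots> = cmod v * (1 - (cmod (\<phi> \<tau>))\<^sup>2)" using nz by (simp add: d_def norm_divide)
        also have "\<dots> \<le> L * (1 - (cmod (\<phi> \<tau>))\<^sup>2)" using v pos by (intro mult_right_mono) auto
        finally show ?thesis .
      qed
      then have "1 * cmod d \<le> k / 2 * (1 - (cmod (\<phi> \<tau>))\<^sup>2)" using c(1) by (simp add: k_def field_simps)
      finally have "2 * (\<phi> \<tau> \<bullet> d) \<le> (1 - \<phi> \<tau> \<bullet> \<phi> \<tau>) * k"
        by (simp add: power2_norm_eq_inner mult.commute)
      then have "2 * (\<phi> \<tau> \<bullet> d) * exp (k * \<tau>) \<le> (1 - \<phi> \<tau> \<bullet> \<phi> \<tau>) * k * exp (k * \<tau>)"
        by (rule mult_right_mono) simp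
      then show ?thesis by (simp add: mult_ac)
    qed
    ultimately show ?thesis by blast
  qed
  have "u 0 \<le> u 1"
  proof -
    obtain l z where "0 < z" "z < 1" "(u has_real_derivative l) (at z)" "u 1 - u 0 = (1 - 0) * l"
      using MVT[OF zero_less_one cont] du real_differentiable_def by blast
    then show ?thesis using du[of z] DERIV_unique by fastforce
  qed
  then have "1 - (cmod (\<phi> 0))\<^sup>2 \<le> (1 - (cmod (\<phi> 1))\<^sup>2) * exp k"
    by (simp add: u_def power2_norm_eq_inner)
  then have "(1 - (cmod (\<phi> 0))\<^sup>2) * exp (-k) \<le> (1 - (cmod (\<phi> 1))\<^sup>2) * exp k * exp (-k)"
    by (rule mult_right_mono) simp
  also have "\<dots> = 1 - (cmod (\<phi> 1))\<^sup>2" by (simp add: mult.assoc flip: exp_add)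
  finally show ?thesis by (simp add: k_def)
qed

text \<open>The disc is complete in the hyperbolic metric: by expansion, all continuations of the branch from
  \<open>\<zeta>0\<close> along segments in \<open>ball s 1\<close> end in one compact subset \<open>K\<close> of the disc. On \<open>K\<close> local inverse
  branches exist with a uniform radius, hence the continuation reaches all of \<open>ball s 1\<close>.\<close>

lemma inverse_branch_if_expanding:
  assumes F: "F holomorphic_on ball 0 1"
    and c: "0 < c" "\<And>\<zeta>. \<zeta> \<in> ball 0 1 \<Longrightarrow> R < cmod (F \<zeta>) \<Longrightarrow> c \<le> cmod (deriv F \<zeta>) * (1 - (cmod \<zeta>)\<^sup>2)"
    and s: "R + 2 < cmod s" and \<zeta>0: "\<zeta>0 \<in> ball 0 1" "F \<zeta>0 \<in> ball s 1"
  shows "\<exists>G. is_lift F {\<zeta>\<in>ball 0 1. R < cmod (F \<zeta>)} (\<lambda>w. w) (ball s 1) G \<and> G (F \<zeta>0) = \<zeta>0"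
proof -
  define T where "T = {\<zeta>\<in>ball 0 1. R < cmod (F \<zeta>)}"
  \<comment> \<open>Segments in \<open>ball s 1\<close> have length at most 2, so \<open>q\<close> bounds \<open>1 - |G w|\<^sup>2\<close> from below.\<close>
  define q where "q = (1 - (cmod \<zeta>0)\<^sup>2) * exp (- (2 * 2 / c))"
  define K where "K = {\<zeta> \<in> cball 0 (sqrt (1 - q)). R + 1 \<le> cmod (F \<zeta>)}"
  have outer: "R + 1 \<le> cmod w" if "w \<in> ball s 1" for w
    using that s norm_triangle_ineq2[of s w] by (simp add: dist_norm)
  have "(cmod \<zeta>0)\<^sup>2 < 1" using \<zeta>0 by (simp add: abs_square_less_1)
  then have q: "0 < q" by (simp add: q_def)
  then have "sqrt (1 - q) < 1" by simp
  then have sub: "cball 0 (sqrt (1 - q)) \<subseteq> ball (0::complex) 1"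
    by (intro subsetI) (simp del: real_sqrt_lt_1_iff)
  have cT: "c \<le> cmod (deriv F \<zeta>) * (1 - (cmod \<zeta>)\<^sup>2)" if "\<zeta> \<in> T" for \<zeta>
    using that c(2) by (simp add: T_def)
  then have nz: "deriv F \<zeta> \<noteq> 0" if "\<zeta> \<in> T" for \<zeta> using that c(1) by fastforce
  have "continuous_on (cball 0 (sqrt (1 - q))) (\<lambda>\<zeta>. cmod (F \<zeta>))"
    using F sub by (intro continuous_on_norm continuous_on_subset[OF holomorphic_on_imp_continuous_on])
  then have "closedin (top_of_set (cball 0 (sqrt (1 - q))))
      (cball 0 (sqrt (1 - q)) \<inter> (\<lambda>\<zeta>. cmod (F \<zeta>)) -` {R + 1..})"
    by (rule continuous_closedin_preimage) simp
  moreover have "cball 0 (sqrt (1 - q)) \<inter> (\<lambda>\<zeta>. cmod (F \<zeta>)) -` {R + 1..} = K" by (auto simp: K_def)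
  ultimately have K: "compact K" using closedin_compact[OF compact_cball] by metis
  have KT: "K \<subseteq> T" using sub by (auto simp: K_def T_def)
  then have KD: "K \<subseteq> ball 0 1" by (auto simp: T_def)
  have KN: "deriv F \<zeta> \<noteq> 0" if "\<zeta> \<in> K" for \<zeta> using that KT nz by blast
  obtain \<delta> where \<delta>: "0 < \<delta>" and
    H: "\<And>\<zeta>. \<zeta> \<in> K \<Longrightarrow> \<exists>H. is_lift F (ball 0 1) (\<lambda>w. w) (ball (F \<zeta>) \<delta>) H \<and> H (F \<zeta>) = \<zeta>"
    using uniform_inverse_branches[OF F open_ball K KD KN] by metis
  have "\<exists>G. is_lift F T (\<lambda>w. w) (ball s 1) G \<and> G (F \<zeta>0) = \<zeta>0"
  proof (rule lift_exists_uniform[OF convex_ball bounded_ball \<zeta>0(2) _ refl _ \<delta>])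
    show "\<zeta>0 \<in> T" using \<zeta>0 outer[OF \<zeta>0(2)] by (simp add: T_def)
    show "locally_injective_on F T"
      unfolding locally_injective_on_def
    proof
      fix \<zeta> assume "\<zeta> \<in> T"
      then have "\<zeta> \<in> ball 0 1" "deriv F \<zeta> \<noteq> 0" using nz by (auto simp: T_def)
      then obtain r where "r > 0" "inj_on F (ball \<zeta> r)"
        using has_complex_derivative_locally_injective[OF F _ open_ball] by metis
      then show "\<exists>N. open N \<and> \<zeta> \<in> N \<and> inj_on F (T \<inter> N)"
        by (intro exI[of _ "ball \<zeta> r"]) (auto intro: inj_on_subset)
    qed
    fix \<rho> G w assume G: "is_lift F T (\<lambda>w. w) (ball s 1 \<inter> cball (F \<zeta>0) \<rho>) G" "G (F \<zeta>0) = \<zeta>0"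
      and w: "w \<in> ball s 1 \<inter> cball (F \<zeta>0) \<rho>"
    define v where "v = w - F \<zeta>0"
    have seg: "F \<zeta>0 + of_real \<tau> * v \<in> ball s 1 \<inter> cball (F \<zeta>0) \<rho>" if "\<tau> \<in> {0..1}" for \<tau>
    proof -
      have "0 \<le> \<rho>" using w by (metis IntD2 mem_cball order_trans zero_le_dist)
      then have "F \<zeta>0 \<in> ball s 1 \<inter> cball (F \<zeta>0) \<rho>" using \<zeta>0(2) by auto
      moreover have "convex (ball s 1 \<inter> cball (F \<zeta>0) \<rho>)" by (intro convex_Int) auto
      ultimately have "(1 - \<tau>) *\<^sub>R F \<zeta>0 + \<tau> *\<^sub>R w \<in> ball s 1 \<inter> cball (F \<zeta>0) \<rho>"
        using w that by (intro convexD) auto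
      moreover have "(1 - \<tau>) *\<^sub>R F \<zeta>0 + \<tau> *\<^sub>R w = F \<zeta>0 + of_real \<tau> * v"
        by (simp add: v_def scaleR_conv_of_real algebra_simps)
      ultimately show ?thesis by simp
    qed
    have "is_lift F T (\<lambda>\<tau>. F \<zeta>0 + of_real \<tau> * v) {0..1} (\<lambda>\<tau>. G (F \<zeta>0 + of_real \<tau> * v))"
      unfolding is_lift_def
    proof (intro conjI ballI subsetI)
      show "continuous_on {0..1} (\<lambda>\<tau>. G (F \<zeta>0 + of_real \<tau> * v))"
        using G(1) seg by (intro continuous_on_compose2[where g = G and f = "\<lambda>\<tau>. F \<zeta>0 + of_real \<tau> * v"]
            continuous_intros) (auto simp: is_lift_def)
    qed (use G(1) seg in \<open>auto simp: is_lift_def\<close>)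
    moreover have "cmod v \<le> 2"
      using w \<zeta>0(2) dist_triangle3[of w "F \<zeta>0" s] by (simp add: v_def dist_norm[of w, symmetric])
    moreover have "T \<subseteq> ball 0 1" by (auto simp: T_def)
    ultimately have "q \<le> 1 - (cmod (G (F \<zeta>0 + of_real 1 * v)))\<^sup>2"
      using segment_lift_stays_inside[OF F c(1) cT, of T "F \<zeta>0" v _ 2] G(2) by (force simp: q_def)
    then have "(cmod (G w))\<^sup>2 \<le> 1 - q" by (simp add: v_def)
    then have "cmod (G w) \<le> sqrt (1 - q)" by (rule real_le_rsqrt)
    moreover have FG: "F (G w) = w" using G(1) w by (auto simp: is_lift_def)
    ultimately have "G w \<in> K" using outer w by (simp add: K_def)
    with H FG obtain H where H: "is_lift F (ball 0 1) (\<lambda>w. w) (ball w \<delta>) H" "H w = G w" by metis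
    have "is_lift F T (\<lambda>w. w) (ball s 1 \<inter> ball w \<delta>) H"
      unfolding is_lift_def
    proof (intro conjI ballI subsetI)
      show "continuous_on (ball s 1 \<inter> ball w \<delta>) H"
        using H(1) by (auto simp: is_lift_def intro: continuous_on_subset)
      show FH: "F (H u) = u" if "u \<in> ball s 1 \<inter> ball w \<delta>" for u
        using H(1) that by (auto simp: is_lift_def)
      fix y assume "y \<in> H ` (ball s 1 \<inter> ball w \<delta>)"
      then obtain u where u: "u \<in> ball s 1 \<inter> ball w \<delta>" "y = H u" by blast
      then have "y \<in> ball 0 1" using H(1) unfolding is_lift_def by blast
      moreover have "R < cmod (F y)" using FH[OF u(1)] u outer[of u] by simp
      ultimately show "y \<in> T" by (simp add: T_def)
    qed
    with H(2) show "\<exists>H. is_lift F T (\<lambda>w. w) (ball s 1 \<inter> ball w \<delta>) H \<and> H w = G w" by blast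
  qed
  then show ?thesis by (simp add: T_def)
qed

text \<open>For \<open>z0\<close> in a component \<open>V\<close> of the preimage of \<open>ball s 1\<close>, take a point of the disc over \<open>z0\<close> and the
  inverse branch \<open>G\<close> of \<open>f \<circ> p\<close> that starts there. Then \<open>\<psi> = p \<circ> G\<close> is a section of \<open>f\<close> with values in
  \<open>V\<close>, by connectedness. It is also a left inverse on \<open>V\<close>: both \<open>\<psi> \<circ> f\<close> and the identity of \<open>V\<close> are
  lifts of \<open>f\<close> through \<open>f\<close>, they agree at \<open>z0\<close>, and \<open>f\<close> is locally injective where it expands.\<close>

lemma regular_value_if_expanding:
  assumes X: "riemann_surface X A" and f: "analytic_to_plane A f X" and p: "disc_covering X A p"
    and \<kappa>: "0 < \<kappa>" "\<And>z. z \<in> X \<Longrightarrow> R < cmod (f z) \<Longrightarrow> \<kappa> \<le> deriv_norm X A f z" and R: "1 \<le> R"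
    and s: "R + 2 < cmod s"
  shows "regular_value X A f s"
  unfolding regular_value_def
proof (intro exI conjI ballI)
  fix V assume V: "V \<in> components {z\<in>X. f z \<in> ball s 1}"
  note pf = disc_covering_facts[OF p]
  define F where "F = f \<circ> p"
  define T where "T = {z\<in>X. R < cmod (f z)}"
  have nzd: "deriv (f \<circ> chart_inv (chart_at A z)) (snd (chart_at A z) z) \<noteq> 0" if "z \<in> T" for z
    using \<kappa>(1) \<kappa>(2)[of z] that by (auto simp: deriv_norm_def Let_def T_def)
  have inj: "locally_injective_on f T"
  proof (rule locally_injective_if_chart_deriv_nonzero[OF X f])
    show "\<exists>c\<in>A. z \<in> fst c \<and> deriv (f \<circ> chart_inv c) (snd c z) \<noteq> 0" if "z \<in> T" for z
      using nzd[OF that] chart_at_facts[OF X, of z] that by (auto simp: T_def)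
  qed (auto simp: T_def)
  have F: "F holomorphic_on ball 0 1"
  proof (rule holomorphic_onI)
    fix \<zeta> :: complex assume \<zeta>: "\<zeta> \<in> ball 0 1"
    then have "p \<zeta> \<in> X" using pf(3) by blast
    then show "F field_differentiable (at \<zeta> within ball 0 1)"
      unfolding F_def field_differentiable_def
      using chart_deriv_chain[OF X f open_ball pf(2) _ chart_at_facts(1)[OF X] \<zeta> chart_at_facts(2)[OF X]] pf(3)
      by (blast intro: has_field_derivative_at_within)
  qed
  have expand: "2 * \<kappa> \<le> cmod (deriv F \<zeta>) * (1 - (cmod \<zeta>)\<^sup>2)" if \<zeta>: "\<zeta> \<in> ball 0 1" "R < cmod (F \<zeta>)" for \<zeta>
  proof -
    have "p \<zeta> \<in> X" using pf(3) \<zeta>(1) by blast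
    then have "\<kappa> \<le> cmod (deriv F \<zeta>) * (1 - (cmod \<zeta>)\<^sup>2) / (2 * cmod (F \<zeta>))"
      using \<kappa>(2)[of "p \<zeta>"] \<zeta>(2) deriv_norm_covering[OF X f p \<zeta>(1)] by (simp add: F_def)
    moreover have "0 < cmod (F \<zeta>)" using \<zeta>(2) R by linarith
    ultimately have "2 * \<kappa> * cmod (F \<zeta>) \<le> cmod (deriv F \<zeta>) * (1 - (cmod \<zeta>)\<^sup>2)"
      by (simp add: pos_le_divide_eq mult_ac)
    \<comment> \<open>Since \<open>R \<ge> 1\<close>, expansion in the cylindrical metric gives expansion in the Euclidean metric.\<close>
    moreover have "2 * \<kappa> * 1 \<le> 2 * \<kappa> * cmod (F \<zeta>)" using \<kappa>(1) \<zeta>(2) R by (intro mult_left_mono) auto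
    ultimately show ?thesis by simp
  qed
  have VS: "V \<subseteq> {z\<in>X. f z \<in> ball s 1}" "connected V"
    using V in_components_subset in_components_connected by blast+
  have outer: "R < cmod w" if "w \<in> ball s 1" for w
    using that s norm_triangle_ineq2[of s w] by (simp add: dist_norm)
  have VT: "V \<subseteq> T" using VS outer by (auto simp: T_def)
  obtain z0 where z0: "z0 \<in> V" using V in_components_nonempty by blast
  then have z0': "z0 \<in> X" "f z0 \<in> ball s 1" using VS by auto
  then obtain \<zeta>0 where \<zeta>0: "\<zeta>0 \<in> ball 0 1" "p \<zeta>0 = z0" using pf(3) by blast
  have "F \<zeta>0 \<in> ball s 1" using \<zeta>0 z0' by (simp add: F_def)
  then obtain G where G: "is_lift F {\<zeta>\<in>ball 0 1. R < cmod (F \<zeta>)} (\<lambda>w. w) (ball s 1) G" "G (F \<zeta>0) = \<zeta>0"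
    using inverse_branch_if_expanding[OF F _ expand s \<zeta>0(1)] \<kappa>(1) by auto
  define \<psi> where "\<psi> = p \<circ> G"
  have G': "continuous_on (ball s 1) G" "\<And>w. w \<in> ball s 1 \<Longrightarrow> G w \<in> ball 0 1"
      "\<And>w. w \<in> ball s 1 \<Longrightarrow> F (G w) = w"
    using G(1) unfolding is_lift_def by blast+
  have f\<psi>: "f (\<psi> w) = w" if "w \<in> ball s 1" for w using G'(3)[OF that] by (simp add: \<psi>_def F_def)
  have \<psi>X: "\<psi> w \<in> X" if "w \<in> ball s 1" for w using G'(2)[OF that] pf(3) by (auto simp: \<psi>_def)
  have \<psi>c: "continuous_on (ball s 1) \<psi>"
    unfolding \<psi>_def using G' pf(2)
    by (intro continuous_on_compose) (auto simp: analytic_from_plane_def intro: continuous_on_subset)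
  have \<psi>0: "\<psi> (f z0) = z0" using G(2) \<zeta>0 by (simp add: \<psi>_def F_def)
  have \<psi>V: "\<psi> w \<in> V" if "w \<in> ball s 1" for w
  proof -
    have "connected (\<psi> ` ball s 1)" using \<psi>c by (intro connected_continuous_image) auto
    moreover have "\<psi> ` ball s 1 \<subseteq> {z\<in>X. f z \<in> ball s 1}" using \<psi>X f\<psi> by auto
    moreover have "V \<inter> \<psi> ` ball s 1 \<noteq> {}" using z0 z0' \<psi>0 by (metis IntI empty_iff image_eqI)
    ultimately have "\<psi> ` ball s 1 \<subseteq> V" using V components_maximal by blast
    then show ?thesis using that by blast
  qed
  have \<psi>f: "\<psi> (f z) = z" if z: "z \<in> V" for z
  proof (rule lift_unique[where G = "\<lambda>z. \<psi> (f z)" and H = "\<lambda>z. z" and F = f and E = f])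
    show "is_lift f T f V (\<lambda>z. \<psi> (f z))"
      unfolding is_lift_def
    proof (intro conjI ballI subsetI)
      show "continuous_on V (\<lambda>z. \<psi> (f z))"
      proof (rule continuous_on_compose2[OF \<psi>c])
        show "continuous_on V f"
          using analytic_to_plane_continuous[OF X f] by (rule continuous_on_subset) (use VS in auto)
      qed (use VS in auto)
    qed (use VS f\<psi> \<psi>V VT in auto)
    show "is_lift f T f V (\<lambda>z. z)" using VT by (auto simp: is_lift_def)
  qed (use VS(2) inj z0 \<psi>0 z in auto)
  have bij: "bij_betw f V (ball s 1)"
    by (rule bij_betw_byWitness[where f' = \<psi>]) (use \<psi>f f\<psi> \<psi>V VS in auto)
  show "conformal_isomorphism A f V (ball s 1)"
    unfolding conformal_isomorphism_def
  proof (intro conjI bij)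
    show "analytic_to_plane A f V"
      unfolding analytic_to_plane_def
    proof
      fix c assume "c \<in> A"
      show "(f \<circ> chart_inv c) holomorphic_on snd c ` (fst c \<inter> V)"
        using analytic_in_chart[OF X f \<open>c \<in> A\<close>] by (rule holomorphic_on_subset) auto
    qed
    have inv: "inv_into V f w = \<psi> w" if "w \<in> ball s 1" for w
      using bij \<psi>V[OF that] f\<psi>[OF that] by (intro inv_into_f_eq) (auto simp: bij_betw_def)
    have hG: "G holomorphic_on ball s 1"
    proof (rule lift_holomorphic[OF F open_ball])
      show "deriv F (G w) \<noteq> 0" if "w \<in> ball s 1" for w
        using expand[OF G'(2)[OF that]] G'(3)[OF that] outer[OF that] \<kappa>(1) by auto
    qed (use G' in \<open>auto intro: holomorphic_intros\<close>)
    show "analytic_from_plane A (inv_into V f) (ball s 1)"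
      unfolding analytic_from_plane_def
    proof (intro conjI ballI)
      show "continuous_on (ball s 1) (inv_into V f)"
        using \<psi>c by (rule continuous_on_eq) (simp add: inv)
      fix c assume c: "c \<in> A"
      have "((snd c \<circ> p) \<circ> G) holomorphic_on {w\<in>ball s 1. \<psi> w \<in> fst c}"
      proof (rule holomorphic_on_compose_gen)
        show "G holomorphic_on {w\<in>ball s 1. \<psi> w \<in> fst c}"
          using hG by (rule holomorphic_on_subset) auto
        show "(snd c \<circ> p) holomorphic_on {w\<in>ball 0 1. p w \<in> fst c}"
          using pf(2) c by (auto simp: analytic_from_plane_def)
        show "G ` {w\<in>ball s 1. \<psi> w \<in> fst c} \<subseteq> {w\<in>ball 0 1. p w \<in> fst c}"
          using G'(2) unfolding \<psi>_def by (simp add: image_subset_iff)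
      qed
      moreover have "{w\<in>ball s 1. inv_into V f w \<in> fst c} = {w\<in>ball s 1. \<psi> w \<in> fst c}"
        using inv by (intro Collect_cong conj_cong) auto
      ultimately show "(snd c \<circ> inv_into V f) holomorphic_on {w\<in>ball s 1. inv_into V f w \<in> fst c}"
        by (simp only:) (rule holomorphic_transform, assumption, use inv in \<open>auto simp: \<psi>_def\<close>)
    qed
  qed
qed auto

lemma deriv_norm_nonneg:
  assumes X: "riemann_surface X A" and f: "analytic_to_plane A f X" and p: "disc_covering X A p"
    and z: "z \<in> X"
  shows "0 \<le> deriv_norm X A f z"
proof -
  obtain \<zeta> where \<zeta>: "\<zeta> \<in> ball 0 1" "p \<zeta> = z" using z disc_covering_facts(3)[OF p] by blast
  have "0 < 1 - (cmod \<zeta>)\<^sup>2" using \<zeta>(1) by (simp add: abs_square_less_1)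
  then show ?thesis using deriv_norm_covering[OF X f p \<zeta>(1)] by (simp add: \<zeta>(2))
qed

text \<open>The norm is nonnegative, so a nonzero limit is positive, and then \<open>f\<close> expands by a definite factor
  outside some disc.\<close>

lemma class_B_if_eta_nonzero:
  assumes X: "hyperbolic_surface X A" and f: "analytic_to_plane A f X" and eta: "eta X A f \<noteq> 0"
  shows "f \<in> class_B X A"
proof -
  obtain p where X: "riemann_surface X A" and p: "disc_covering X A p"
    using X unfolding hyperbolic_surface_def by blast
  define g where "g = (\<lambda>R::real. INF z\<in>{z\<in>X. cmod (f z) > R}. ereal (deriv_norm X A f z))"
  have eta_g: "eta X A f = (SUP R. g R)" by (simp add: g_def eta_eq_SUP)
  have "0 \<le> g 0" unfolding g_def
    using deriv_norm_nonneg[OF X f p] by (intro INF_greatest) auto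
  also have "\<dots> \<le> eta X A f" unfolding eta_g by (rule SUP_upper) simp
  finally have "0 < eta X A f" using eta by simp
  then obtain R where "0 < g R" unfolding eta_g by (auto simp: less_SUP_iff)
  then obtain \<kappa> where \<kappa>: "0 < ereal \<kappa>" "ereal \<kappa> < g R" using ereal_dense2 by blast
  define R' where "R' = max R 1"
  have "\<kappa> \<le> deriv_norm X A f z" if "z \<in> X" "R' < cmod (f z)" for z
  proof -
    have "g R \<le> ereal (deriv_norm X A f z)"
      unfolding g_def by (rule INF_lower) (use that in \<open>auto simp: R'_def\<close>)
    then show ?thesis using \<kappa>(2) by (metis ereal_less_eq(3) less_imp_le order_trans)
  qed
  then have "regular_value X A f s" if "R' + 2 < cmod s" for s
    using \<kappa>(1) that by (intro regular_value_if_expanding[OF X f p, of \<kappa> R']) (auto simp: R'_def)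
  then have "cmod s \<le> R' + 2" if "s \<in> singular_values X A f" for s
    using that by (force simp: singular_values_def not_less[symmetric])
  then have "bounded (singular_values X A f)" by (auto simp: bounded_iff)
  then show ?thesis using f by (simp add: class_B_def)
qed

theorem theorem1p8:
  fixes \<Omega> :: "'a::t2_space set" and A :: "'a chart set" and f :: "'a \<Rightarrow> complex"
  assumes "hyperbolic_surface \<Omega> A"
    and "analytic_to_plane A f \<Omega>"
    and "\<not> bounded (f ` \<Omega>)"
  shows "(eta \<Omega> A f = \<infinity> \<and> f \<in> class_B \<Omega> A) \<or> (eta \<Omega> A f = 0 \<and> f \<notin> class_B \<Omega> A)"
  using eta_infinite_if_class_B class_B_if_eta_nonzero assms(1,2) by blast

end
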